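(* (i) Let $0<q<1$, $z\in\mathbb{C}\setminus\{0\}$ and $\nu>-1$. For $n\in\mathbb{N}$ define $e(n)$ by $$J_\nu^{(2)}\left(2\sqrt{zq^{-2n-\nu}};q\right)=\frac{z^{n+\nu/2}\left\{\theta_4(z^{-1};q)+e(n)\right\}}{(-1)^n(q;q)_\infty^2\,q^{n^2+n\nu+\nu^2/2}}.$$ Then for all sufficiently large $n$, $$|e(n)|\le 12\,\theta_3(|z|^{-1};q)\left\{\frac{q^{n/2}}{1-q}+\frac{q^{\lfloor n/2\rfloor^2}}{|z|^{\lfloor n/2\rfloor}}\right\}.$$ (ii) Let $\nu>-1$, $0<a<\frac12$ and $u\in\mathbb{R}$ be fixed, and let $n\in\mathbb{N}$. Then, as $n\to\infty$, $$J_\nu^{(2)}\left(2i\exp\left(\pi(u+n^{1-a}+\nu n^{-a}/2)\right);\exp(-\pi n^{-a})\right)=\frac{i^\nu\exp\left\{\pi n^{-a}(n^a u+n+\nu/2)^2\right\}\left\{1+\mathcal{O}\left(\exp(-\pi n^a)\right)\right\}}{2\sqrt{n^a}\,\exp\left\{\pi\left(n^{-a}/12-n^a/3-n^{-a}\nu^2/4\right)\right\}},$$ and $$J_\nu^{(2)}\left(2\exp\left(\pi(u+n^{1-a}+\nu n^{-a}/2)\right);\exp(-\pi n^{-a})\right)=\frac{\exp\left\{\pi n^{-a}(n^a u+n+\nu/2)^2\right\}\left\{\cos(\pi n^a u)+\mathcal{O}\left(\exp(-2\pi n^a)\right)\right\}}{(-1)^n\sqrt{n^a}\,\exp\left\{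\pi\left(n^{-a}/12-n^a/12-\nu^2n^{-a}/4\right)\right\}}.$$
   Context: For $0<q<1$: $(c;q)_\infty=\prod_{k=0}^\infty(1-cq^k)$, $(c;q)_k=\prod_{j=0}^{k-1}(1-cq^j)$, $(b,c;q)_k=(b;q)_k(c;q)_k$. Jackson's $q$-Bessel function of the second kind is, for $\nu>-1$, $$J_\nu^{(2)}(z;q)=\frac{(q^{\nu+1};q)_\infty}{(q;q)_\infty}\sum_{k=0}^\infty\frac{(-1)^k(z/2)^{\nu+2k}}{(q,q^{\nu+1};q)_k}q^{k(\nu+k)}.$$ Square roots and non-integer powers ($\sqrt{\cdot}$, $(z/2)^\nu$, $z^{\nu/2}$, $i^\nu=e^{i\pi\nu/2}$) are principal values. The theta functions are $\theta_3(z;q)=\sum_{k=-\infty}^\infty q^{k^2}z^k$ and $\theta_4(z;q)=\sum_{k=-\infty}^\infty(-1)^kq^{k^2}z^k$ for $z\in\mathbb{C}\setminus\{0\}$. $\lfloor x\rfloor$ is the greatest integer $\le x$. In (i) "sufficiently large" may depend on $q,z,\nu$. In (ii) the $\mathcal{O}$ terms are as $n\to\infty$ with $a,u,\nu$ fixed (implied constants may depend on them). *)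

theory Defs
  imports "HOL-Complex_Analysis.Complex_Analysis" "HOL-Library.Landau_Symbols"
begin

definition qpoch :: "'a::real_normed_field \<Rightarrow> 'a \<Rightarrow> nat \<Rightarrow> 'a" where
  "qpoch c q k = (\<Prod>j<k. 1 - c * q ^ j)"

definition qpoch_inf :: "'a::real_normed_field \<Rightarrow> 'a \<Rightarrow> 'a" where
  "qpoch_inf c q = (\<Prod>k. 1 - c * q ^ k)"

text \<open>
  Jackson's second \<open>q\<close>-Bessel function, for \<open>0 < q < 1\<close>, \<open>\<nu> > -1\<close> and \<open>z \<noteq> 0\<close>. The complex
  \<open>powr\<close> is the principal power. The point \<open>z = 0\<close> is outside the intended domain
  because \<open>0 powr 0 = 0\<close>.
\<close>

definition jackson_J2 :: "real \<Rightarrow> complex \<Rightarrow> real \<Rightarrow> complex" where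
  "jackson_J2 \<nu> z q =
     complex_of_real (qpoch_inf (q powr (\<nu> + 1)) q / qpoch_inf q q) *
     (\<Sum>k. (-1) ^ k * (z / 2) powr complex_of_real (\<nu> + 2 * real k)
           / complex_of_real (qpoch q q k * qpoch (q powr (\<nu> + 1)) q k)
           * complex_of_real (q powr (real k * (\<nu> + real k))))"

text \<open>
  Theta functions as unordered sums over the integers, absolutely convergent for
  \<open>0 < q < 1\<close> and \<open>z \<noteq> 0\<close>; \<open>z\<close> may be real or complex.
\<close>

definition theta3 :: "'a::real_normed_field \<Rightarrow> real \<Rightarrow> 'a" where
  "theta3 z q = (\<Sum>\<^sub>\<infinity>k\<in>(UNIV :: int set). of_real (q powi (k ^ 2)) * z powi k)"

definition theta4 :: "'a::real_normed_field \<Rightarrow> real \<Rightarrow> 'a" where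
  "theta4 z q = (\<Sum>\<^sub>\<infinity>k\<in>(UNIV :: int set). (-1) powi k * of_real (q powi (k ^ 2)) * z powi k)"

end

theory Submission
  imports Defs "HOL-Probability.Characteristic_Functions" "HOL-Real_Asymp.Real_Asymp"
begin

text \<open>
  Completing the square in the exponent of \<open>q\<close> turns the \<open>q\<close>-Bessel series into the series of
  \<open>\<theta>\<^sub>4(1/z; q)\<close>, cut off on one side and weighted by tails of \<open>q\<close>-Pochhammer products. A weight
  differs from 1 by at most \<open>2 q\<^sup>k / (1 - q)\<close> and always by at most 1, which bounds the error
  uniformly in \<open>n\<close> and \<open>q\<close>; so the bound may be used with \<open>q\<close> depending on \<open>n\<close>. The asymptotics for
  \<open>q = exp (-\<pi>/T)\<close>, \<open>T \<longlonglongrightarrow> \<infinity>\<close>, then follow from Poisson summation for the Gaussian, applied to the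
  theta function and, through the pentagonal number theorem, to \<open>(q; q)\<^sub>\<infinity>\<close>. Poisson summation in
  turn is the statement that the periodized Gaussian and its dual series have the same cosine
  coefficients.
\<close>

section \<open>Poisson summation for the Gaussian\<close>

text \<open>The two formulas of (ii) use one error bound on different scales. That bound is a
  multiple of \<open>theta3\<close>, which for |z| = exp(2 pi u) has size sqrt T exp(pi u^2 T). For
  negative z the series of \<open>theta4\<close> has positive terms and is just as large. For
  positive z its signs shift the dual frequencies by 1/2, so the main term is smaller by exp(-pi
  T/4). The cut-off error must then be smaller than exp(-pi T/4) exp(-2 pi T) up to a constant, and
  for this reason it is driven down to 2 exp(-3 pi T). The assumption a < 1/2 makes this possible:
  for T = n^a the quotient n/T^2 tends to infinity, while q^(n/2) = exp(-pi n/(2T)). The pentagonal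
  exponent k(3k+1)/2 equals (3/2)(k+1/6)^2 - 1/24. Hence the Euler product is itself an alternating
  Gaussian sum, sampled at 1/6, and the same Poisson formula gives its behaviour as q tends to
  1.\<close>

lemma gaussian_cos_integral:
  fixes t w :: real
  assumes "t > 0"
  shows "has_bochner_integral lborel (\<lambda>x. exp (- pi * t * x\<^sup>2) * cos (2 * pi * w * x))
           (exp (- pi * w\<^sup>2 / t) / sqrt t)"
proof -
  \<comment> \<open>Scaling by \<open>r = sqrt (2 * pi * t)\<close> turns the Gaussian into a
    standard normal density, and \<open>s\<close> is the frequency with s r = 2 pi w. The integral
    becomes the real part of the normal characteristic function.\<close>
  define s where "s = 2 * pi * w / sqrt (2 * pi * t)"
  have pt: "0 < 2 * pi * t" using assms by simp
  define r where "r = sqrt (2 * pi * t)"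
  have r: "r > 0" "r\<^sup>2 = 2 * pi * t" using pt by (auto simp: r_def)
  have dist: "has_bochner_integral std_normal_distribution (\<lambda>x. cos (s * x)) (exp (- s\<^sup>2 / 2))"
  proof -
    interpret real_distribution std_normal_distribution
      by (rule real_dist_normal_dist)
    have int: "integrable std_normal_distribution (\<lambda>x. iexp (s * x))"
      by (rule integrable_iexp) auto
    have "(CLINT x|std_normal_distribution. iexp (s * x)) = complex_of_real (exp (- s\<^sup>2 / 2))"
      using char_std_normal_distribution by (simp add: char_def fun_eq_iff)
    then have "Re (CLINT x|std_normal_distribution. iexp (s * x)) = exp (- s\<^sup>2 / 2)"
      by (metis Re_complex_of_real)
    moreover have "Re (iexp (s * x)) = cos (s * x)" for x
      by (simp add: Re_exp)
    ultimately show ?thesis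
      using integrable_Re[OF int] integral_Re[OF int] by (simp add: has_bochner_integral_iff)
  qed
  have std: "has_bochner_integral lborel (\<lambda>x. std_normal_density x * cos (s * x)) (exp (- s\<^sup>2 / 2))"
    using dist
    by (subst (asm) has_bochner_integral_iff, subst (asm) integral_density, simp, simp, simp, 
        subst (asm) integrable_density, simp, simp, simp, 
        subst has_bochner_integral_iff, simp only: real_scaleR_def simp_thms)
  have scale: "exp (- s\<^sup>2 / 2) /\<^sub>R \<bar>r\<bar> = exp (- s\<^sup>2 / 2) / r"
    by (simp only: abs_of_pos[OF r(1)] real_scaleR_def divide_inverse mult.commute)
  have aff: "has_bochner_integral lborel
     (\<lambda>x. std_normal_density (0 + r * x) * cos (s * (0 + r * x))) (exp (- s\<^sup>2 / 2) /\<^sub>R \<bar>r\<bar>)"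
    using lborel_has_bochner_integral_real_affine_iff[of r "\<lambda>x. std_normal_density x * cos (s * x)"
      "exp (- s\<^sup>2 / 2)" 0] std r(1) by blast
  have "has_bochner_integral lborel
     (\<lambda>x. sqrt (2 * pi) * (std_normal_density (r * x) * cos (s * (r * x))))
      (sqrt (2 * pi) * (exp (- s\<^sup>2 / 2) / r))"
    by (rule has_bochner_integral_mult_right) (rule aff[unfolded scale add_0_left])
  moreover have "sqrt (2 * pi) * (std_normal_density (r * x) * cos (s * (r * x)))
    = exp (- pi * t * x\<^sup>2) * cos (2 * pi * w * x)" for x
  proof -
    have 1: "s * (r * x) = 2 * pi * w * x"
      using r(1) unfolding s_def r_def[symmetric] by simp
    have 2: "- (r * x)\<^sup>2 / 2 = - pi * t * x\<^sup>2"
      unfolding power_mult_distrib r(2) by simp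
    show ?thesis unfolding 1 std_normal_density_def 2 by simp
  qed
  moreover have "sqrt (2 * pi) * (exp (- s\<^sup>2 / 2) / r) = exp (- pi * w\<^sup>2 / t) / sqrt t"
  proof -
    have 1: "- s\<^sup>2 / 2 = - pi * w\<^sup>2 / t"
      unfolding s_def r_def[symmetric] power_divide power_mult_distrib r(2)
      using assms by (simp add: power2_eq_square)
    have 2: "r = sqrt (2 * pi) * sqrt t" unfolding r_def by (simp only: real_sqrt_mult)
    show ?thesis unfolding 1 2 by simp
  qed
  ultimately show ?thesis by (simp only:)
qed

text \<open>The substitution s = cos(2 pi x) turns even functions on a period into functions on
  [-1,1], where Weierstrass approximation by polynomials is available. Orthogonality to all cosines
  gives orthogonality to all polynomials in cos(2 pi x), hence approximately to \<open>h\<close>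
  itself, so the integral of h^2 vanishes.\<close>

lemma even_cosine_uniqueness:
  fixes h :: "real \<Rightarrow> real"
  assumes cont: "continuous_on {-1/2..1/2} h"
    and even: "\<And>x. h (- x) = h x"
    and orth: "\<And>m::nat. integral {-1/2..1/2} (\<lambda>x. h x * cos (2 * pi * real m * x)) = 0"
    and x: "x \<in> {-1/2..1/2}"
  shows "h x = 0"
proof -
  have [continuous_intros]: "continuous_on {-1/2..1/2} h" by fact
  define H where "H s = h (arccos s / (2 * pi))" for s
  have H: "H (cos (2 * pi * y)) = h y" if "y \<in> {-1/2..1/2}" for y
  proof -
    have "arccos (cos (2 * pi * \<bar>y\<bar>)) = 2 * pi * \<bar>y\<bar>"
      using that by (intro arccos_cos) (auto simp: abs_if field_simps mult_left_le)
    moreover have "cos (2 * pi * \<bar>y\<bar>) = cos (2 * pi * y)" by (auto simp: abs_if)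
    ultimately show ?thesis unfolding H_def by (auto simp: abs_if even)
  qed
  have contH: "continuous_on {-1..1} H"
    unfolding H_def
  proof (rule continuous_on_compose2[OF cont])
    show "continuous_on {- 1..1} (\<lambda>x. arccos x / (2 * pi))"
      by (intro continuous_intros) auto
    show "(\<lambda>x. arccos x / (2 * pi)) ` {- 1..1} \<subseteq> {- 1 / 2..1 / 2}"
    proof safe
      fix y :: real assume "y \<in> {-1..1}"
      then have "0 \<le> arccos y" "arccos y \<le> pi" by (auto intro: arccos_lbound arccos_ubound)
      then show "arccos y / (2 * pi) \<in> {- 1 / 2..1 / 2}" using pi_gt_zero by (simp add: field_simps)
    qed
  qed
  have int: "(\<lambda>x. h x * f x) integrable_on {-1/2..1/2}" if "continuous_on {-1/2..1/2} f" for f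
    using that by (intro integrable_continuous_real continuous_intros)
  \<comment> \<open>The claim is made for every \<open>m\<close> at once, because the product-to-sum
    formula trades one power of the cosine for the neighbouring frequencies m+1 and m-1. At m = 0
    the cosine factor simply becomes frequency 1.\<close>
  have mono: "integral {-1/2..1/2} (\<lambda>x. h x * (cos (2 * pi * x) ^ i * cos (2 * pi * real m * x))) = 0" for i m
  proof (induction i arbitrary: m)
    case 0
    then show ?case using orth by simp
  next
    case (Suc i)
    let ?f = "\<lambda>m x. h x * (cos (2 * pi * x) ^ i * cos (2 * pi * real m * x))"
    show ?case
    proof (cases m)
      case 0
      then show ?thesis using Suc.IH[of 1] by (simp add: algebra_simps)
    next
      case (Suc m')
      have "cos (2 * pi * x) * cos (2 * pi * real m * x)
         = (cos (2 * pi * real (Suc m) * x) + cos (2 * pi * real m' * x)) / 2" for x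
      proof -
        have "cos (2 * pi * x) * cos (2 * pi * real m * x) = (cos (2 * pi * real m * x - 2 * pi * x)
            + cos (2 * pi * real m * x + 2 * pi * x)) / 2"
          by (subst mult.commute) (rule cos_times_cos)
        also have "2 * pi * real m * x - 2 * pi * x = 2 * pi * real m' * x"
          by (simp add: Suc algebra_simps)
        also have "2 * pi * real m * x + 2 * pi * x = 2 * pi * real (Suc m) * x"
          by (simp add: algebra_simps)
        finally show ?thesis by (simp only: add.commute)
      qed
      then have "h x * (cos (2 * pi * x) ^ Suc i * cos (2 * pi * real m * x))
         = (?f (Suc m) x + ?f m' x) / 2" for x
        by (simp only: power_Suc mult.commute[of "cos _" "cos _ ^ i"] mult.assoc)
           (simp only: add_divide_distrib distrib_left times_divide_eq_right)
      then have "integral {-1/2..1/2} (\<lambda>x. h x * (cos (2 * pi * x) ^ Suc i * cos (2 * pi * real m * x)))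
          = integral {-1/2..1/2} (\<lambda>x. (?f (Suc m) x + ?f m' x) / 2)"
        by presburger
      also have "\<dots> = (integral {-1/2..1/2} (?f (Suc m)) + integral {-1/2..1/2} (?f m')) / 2"
        by (simp only: integral_divide, subst integral_add) (rule int, intro continuous_intros, rule int, intro continuous_intros, rule refl)
      also have "\<dots> = 0" by (simp only: Suc.IH) simp
      finally show ?thesis .
    qed
  qed
  have poly: "integral {-1/2..1/2} (\<lambda>x. h x * g (cos (2 * pi * x))) = 0"
    if g: "real_polynomial_function g" for g
  proof -
    obtain a n where g: "g = (\<lambda>x. \<Sum>i\<le>n. a i * x ^ i)"
      using g real_polynomial_function_iff_sum by blast
    have "integral {-1/2..1/2} (\<lambda>x. h x * g (cos (2 * pi * x)))
       = integral {-1/2..1/2} (\<lambda>x. \<Sum>i\<le>n. a i * (h x * cos (2 * pi * x) ^ i))"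
      by (simp add: g sum_distrib_left algebra_simps)
    also have "\<dots> = (\<Sum>i\<le>n. integral {-1/2..1/2} (\<lambda>x. a i * (h x * cos (2 * pi * x) ^ i)))"
      by (rule integral_sum[OF finite_atMost integrable_on_mult_right]) (rule int, intro continuous_intros)
    also have "\<dots> = 0"
      using mono[of _ 0] by simp
    finally show ?thesis .
  qed
  have "bounded (h ` {-1/2..1/2})"
    by (rule compact_imp_bounded[OF compact_continuous_image[OF cont compact_Icc]])
  then obtain M where "\<forall>y\<in>h ` {-1/2..1/2}. \<bar>y\<bar> \<le> M"
    unfolding bounded_iff real_norm_def by blast
  then have M: "\<bar>h y\<bar> \<le> M" if "y \<in> {-1/2..1/2}" for y
    using that by blast
  \<comment> \<open>One factor \<open>h\<close> is replaced by its distance to an approximating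
    polynomial in the cosine; the polynomial part integrates to 0.\<close>
  have le: "integral {-1/2..1/2} (\<lambda>x. h x * h x) \<le> e * M" if e: "e > 0" for e
  proof -
    obtain g where g: "real_polynomial_function g" "\<And>s. s \<in> {-1..1} \<Longrightarrow> \<bar>H s - g s\<bar> < e"
      by (rule Stone_Weierstrass_real_polynomial_function[OF compact_Icc contH e]) blast
    have cg [continuous_intros]: "continuous_on {-1/2..1/2} (\<lambda>x. g (cos (2 * pi * x)))"
      using g(1) by (intro continuous_on_compose2[OF continuous_on_polymonial_function[of g UNIV]]
          continuous_intros) (auto simp: real_polynomial_function_eq)
    have "integral {-1/2..1/2} (\<lambda>x. h x * h x)
      = integral {-1/2..1/2} (\<lambda>x. h x * (h x - g (cos (2 * pi * x))) + h x * g (cos (2 * pi * x)))"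
      by (simp add: algebra_simps)
    also have "\<dots> = integral {-1/2..1/2} (\<lambda>x. h x * (h x - g (cos (2 * pi * x))))"
    proof -
      have "(\<lambda>x. h x * (h x - g (cos (2 * pi * x)))) integrable_on {-1/2..1/2}"
        "(\<lambda>x. h x * g (cos (2 * pi * x))) integrable_on {-1/2..1/2}"
        by (rule int, intro continuous_intros)+
      from integral_add[OF this] show ?thesis using poly[OF g(1)] by simp
    qed
    also have "\<dots> \<le> integral {-1/2..1/2::real} (\<lambda>x. e * M)"
    proof (rule integral_le)
      fix y :: real assume y: "y \<in> {-1/2..1/2}"
      have "\<bar>h y - g (cos (2 * pi * y))\<bar> \<le> e"
        using g(2)[of "cos (2 * pi * y)"] H[OF y] by simp
      then have "\<bar>h y * (h y - g (cos (2 * pi * y)))\<bar> \<le> M * e"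
        unfolding abs_mult using M[OF y] that by (intro mult_mono) auto
      then show "h y * (h y - g (cos (2 * pi * y))) \<le> e * M"
        by (simp add: mult.commute)
    qed (rule int, intro continuous_intros, rule integrable_const_ivl)
    finally show ?thesis by simp
  qed
  then have "integral {-1/2..1/2} (\<lambda>x. h x * h x) \<le> 0"
  proof -
    have M0: "0 \<le> M" using M[of 0] abs_ge_zero[of "h 0"] by (simp del: abs_ge_zero)
    show ?thesis
    proof (rule field_le_epsilon)
      fix e :: real assume e: "e > 0"
      \<comment> \<open>The bound \<open>M\<close> may be 0, so the tolerance is divided by M +
        1.\<close>
      have "integral {-1/2..1/2} (\<lambda>x. h x * h x) \<le> e / (M + 1) * M"
        using e M0 by (intro le) auto
      also have "\<dots> \<le> e" using e M0 by (simp add: field_simps)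
      finally show "integral {-1/2..1/2} (\<lambda>x. h x * h x) \<le> 0 + e" by simp
    qed
  qed
  moreover have "0 \<le> integral {-1/2..1/2} (\<lambda>x. h x * h x)"
    by (rule integral_nonneg, rule int, rule cont) simp
  ultimately have "integral {-1/2..1/2} (\<lambda>x. h x * h x) = 0" by simp
  then have "\<forall>x\<in>{-1/2..1/2}. h x * h x = 0"
    by (subst (asm) integral_eq_0_iff, intro continuous_intros) auto
  then show ?thesis using x by simp
qed

section \<open>Sums over the integers, periodization and cosine integrals\<close>

lemma summable_on_int:
  fixes f :: "int \<Rightarrow> real"
  assumes "\<And>k. 0 \<le> f k" "summable (\<lambda>n. f (int n))" "summable (\<lambda>n. f (- int n))"
  shows "f summable_on UNIV"
proof -
  have "(f \<circ> int) summable_on UNIV"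
    using assms by (subst summable_on_UNIV_nonneg_real_iff) (auto simp: o_def)
  then have 1: "f summable_on range int"
    by (subst summable_on_reindex) (auto simp: inj_on_def)
  have "(f \<circ> (\<lambda>n. - int n)) summable_on UNIV"
    using assms by (subst summable_on_UNIV_nonneg_real_iff) (auto simp: o_def)
  then have 2: "f summable_on range (\<lambda>n. - int n)"
    by (subst summable_on_reindex) (auto simp: inj_on_def)
  \<comment> \<open>Both ranges contain 0, so the overlap is removed before the union is
    formed.\<close>
  have "f summable_on (range (\<lambda>n. - int n) - range int)"
    by (rule summable_on_subset_banach[OF 2]) auto
  then have "f summable_on (range int \<union> (range (\<lambda>n. - int n) - range int))"
    by (intro summable_on_Un_disjoint 1) auto
  moreover have "range int \<union> (range (\<lambda>n. - int n) - range int) = UNIV"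
  proof -
    have "k \<in> range int \<or> k \<in> range (\<lambda>n. - int n)" for k
      by (cases k rule: int_cases2) auto
    then show ?thesis by blast
  qed
  ultimately show ?thesis by simp
qed

text \<open>Symmetric intervals eventually contain every finite set of integers. This links
  unordered sums to the partial sums that Fourier and pentagonal arguments produce.\<close>

lemma has_sum_int_imp_tendsto:
  assumes "(f has_sum S) (UNIV :: int set)"
  shows "(\<lambda>N. \<Sum>k\<in>{-int N..int N}. f k) \<longlonglongrightarrow> S"
proof -
  have "filterlim (\<lambda>N. {-int N..int N}) (finite_subsets_at_top UNIV) sequentially"
    unfolding filterlim_finite_subsets_at_top
  proof safe
    fix X :: "int set" assume X: "finite X"
    define M where "M = nat (Max (insert 0 (abs ` X)))"
    have "X \<subseteq> {-int N..int N}" if "N \<ge> M" for N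
    proof
      fix x assume "x \<in> X"
      then have "\<bar>x\<bar> \<le> Max (insert 0 (abs ` X))" using X by (intro Max_ge) auto
      then show "x \<in> {-int N..int N}" using that unfolding M_def by simp linarith
    qed
    then show "\<forall>\<^sub>F N in sequentially. finite {-int N..int N} \<and> X \<subseteq> {-int N..int N} \<and> {-int N..int N} \<subseteq> UNIV"
      unfolding eventually_sequentially by blast
  qed
  from filterlim_compose[OF assms[unfolded has_sum_def] this] show ?thesis .
qed

lemma symmetric_interval_sum:
  fixes f :: "int \<Rightarrow> 'a::comm_monoid_add"
  shows "(\<Sum>k\<in>{-int N..int N}. f k) = f 0 + (\<Sum>j<N. f (int (Suc j)) + f (- int (Suc j)))"
proof (induction N)
  case (Suc N)
  have "{-int (Suc N)..int (Suc N)} = insert (int (Suc N)) (insert (- int (Suc N)) {-int N..int N})"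
    by auto
  then show ?case using Suc by (simp add: ac_simps)
qed simp

text \<open>The translates of the unit window by the integers from -N to N tile the interval; hence
  its half-integer end points.\<close>

lemma integral_periodization:
  fixes f :: "real \<Rightarrow> real"
  assumes cont: "continuous_on UNIV f"
  shows "((\<lambda>x. \<Sum>k\<in>{-int N..int N}. f (x + of_int k)) has_integral
           integral {-(real N + 1/2)..real N + 1/2} f) {-1/2..1/2}"
proof (induction N)
  have int: "f integrable_on {a..b}" for a b
    using cont by (intro integrable_continuous_real) (auto intro: continuous_on_subset)
  case 0
  then show ?case using integrable_integral[OF int] by simp
next
  have int: "f integrable_on {a..b}" for a b
    using cont by (intro integrable_continuous_real) (auto intro: continuous_on_subset)
  case (Suc N)
  have shift: "((\<lambda>x. f (x + c)) has_integral integral {c - 1/2..c + 1/2} f) {-1/2..1/2}" for c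
    using has_integral_shift_real_ivl[OF integrable_integral[OF int, of "c - 1/2" "c + 1/2"], of c] by simp
  let ?R = "real N + 1/2"
  have "integral {-(?R + 1)..-?R} f + integral {-?R..?R} f = integral {-(?R + 1)..?R} f"
    by (rule Henstock_Kurzweil_Integration.integral_combine[OF _ _ int]) auto
  moreover have "integral {-(?R + 1)..?R} f + integral {?R..?R + 1} f = integral {-(?R + 1)..?R + 1} f"
    by (rule Henstock_Kurzweil_Integration.integral_combine[OF _ _ int]) auto
  moreover have ends: "real (Suc N) + 1/2 = ?R + 1" "real (Suc N) - 1/2 = ?R"
    "- real (Suc N) - 1/2 = -(?R + 1)" "- real (Suc N) + 1/2 = - ?R"
    by simp_all
  ultimately have eq: "integral {-(real (Suc N) + 1/2)..real (Suc N) + 1/2} f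
    = integral {-?R..?R} f + (integral {real (Suc N) - 1/2..real (Suc N) + 1/2} f
     + integral {-real (Suc N) - 1/2..-real (Suc N) + 1/2} f)"
    unfolding ends by linarith
  have sum: "(\<Sum>k\<in>{-int (Suc N)..int (Suc N)}. f (x + of_int k)) =
     (\<Sum>k\<in>{-int N..int N}. f (x + of_int k)) + (f (x + real (Suc N)) + f (x + - real (Suc N)))" for x
    unfolding symmetric_interval_sum by (simp add: ac_simps)
  show ?case
    unfolding sum eq by (intro has_integral_add Suc shift)
qed

text \<open>Dominated convergence, with |f| as majorant of the truncations.\<close>

lemma has_bochner_integral_symmetric_limit:
  fixes f :: "real \<Rightarrow> real"
  assumes f: "has_bochner_integral lborel f I"
  shows "(\<lambda>N. integral {-(real N + 1/2)..real N + 1/2} f) \<longlonglongrightarrow> I"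
proof -
  have int: "integrable lborel f" and I: "I = (LINT x|lborel. f x)"
    using f by (auto simp: has_bochner_integral_iff)
  note [measurable] = borel_measurable_integrable[OF int]
  have "(\<lambda>N. LINT x|lborel. indicator {-(real N + 1/2)..real N + 1/2} x *\<^sub>R f x) \<longlonglongrightarrow> (LINT x|lborel. f x)"
  proof (rule integral_dominated_convergence)
    show "integrable lborel (\<lambda>x. norm (f x))" using int by (rule integrable_norm)
    show "AE x in lborel. (\<lambda>N. indicator {-(real N + 1/2)..real N + 1/2} x *\<^sub>R f x) \<longlonglongrightarrow> f x"
    proof (rule AE_I2)
      fix x :: real
      have "\<forall>\<^sub>F N in sequentially. indicator {-(real N + 1/2)..real N + 1/2} x *\<^sub>R f x = f x"
        using eventually_ge_at_top[of "nat \<lceil>\<bar>x\<bar>\<rceil>"]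
      proof eventually_elim
        case (elim N)
        then have "\<bar>x\<bar> \<le> real N" by linarith
        then show ?case by (auto simp: indicator_def)
      qed
      then show "(\<lambda>N. indicator {-(real N + 1/2)..real N + 1/2} x *\<^sub>R f x) \<longlonglongrightarrow> f x"
        by (rule tendsto_eventually)
    qed
  qed (auto simp: indicator_def)
  moreover have "(LINT x|lborel. indicator {-(real N + 1/2)..real N + 1/2} x *\<^sub>R f x)
     = integral {-(real N + 1/2)..real N + 1/2} f" for N
  proof -
    have "set_integrable lborel {-(real N + 1/2)..real N + 1/2} f"
      unfolding set_integrable_def by (rule integrable_mult_indicator[OF _ int]) auto
    from set_borel_integral_eq_integral(2)[OF this] show ?thesis
      unfolding set_lebesgue_integral_def .
  qed
  ultimately show ?thesis unfolding I by simp
qed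

lemma has_integral_cos_period:
  "((\<lambda>x. cos (2 * pi * of_int k * x)) has_integral (if k = 0 then 1 else 0)) {-1/2..1/2::real}"
proof (cases "k = 0")
  case True
  then show ?thesis using has_integral_const_real[of "1::real" "-1/2" "1/2"] by simp
next
  case False
  have "((\<lambda>x. cos (2 * pi * of_int k * x)) has_integral
     (sin (2 * pi * of_int k * (1/2)) / (2 * pi * of_int k) - sin (2 * pi * of_int k * (-1/2)) / (2 * pi * of_int k)))
      {-1/2..1/2::real}"
  proof (rule fundamental_theorem_of_calculus)
    fix x :: real
    show "((\<lambda>x. sin (2 * pi * of_int k * x) / (2 * pi * of_int k)) has_vector_derivative
      cos (2 * pi * of_int k * x)) (at x within {-1/2..1/2})"
      unfolding has_real_derivative_iff_has_vector_derivative[symmetric]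
      using False by (auto intro!: derivative_eq_intros)
  qed simp
  moreover have "sin (2 * pi * of_int k * (1/2)) = 0"
    using sin_times_pi_eq_0[of "of_int k"] by (simp add: mult.commute)
  moreover have "sin (2 * pi * of_int k * (-1/2)) = 0"
    using sin_times_pi_eq_0[of "of_int k"] by (simp add: mult.commute)
  ultimately show ?thesis using False by simp
qed

lemma has_integral_cos_cos:
  fixes j m :: nat
  shows "((\<lambda>x. cos (2 * pi * real (Suc j) * x) * cos (2 * pi * real m * x)) has_integral
     (if m = Suc j then 1/2 else 0)) {-1/2..1/2}"
proof -
  \<comment> \<open>The sum frequency is positive and integrates to 0, so only the difference
    frequency can contribute, with weight 1/2.\<close>
  have "((\<lambda>x. (cos (2 * pi * of_int (int (Suc j) - int m) * x) + cos (2 * pi * of_int (int (Suc j) + int m) * x)) / 2)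
    has_integral ((if int (Suc j) - int m = 0 then 1 else 0) + (if int (Suc j) + int m = 0 then 1 else 0)) / 2) {-1/2..1/2}"
    by (intro has_integral_divide has_integral_add has_integral_cos_period)
  moreover have "cos (2 * pi * real (Suc j) * x) * cos (2 * pi * real m * x) =
     (cos (2 * pi * of_int (int (Suc j) - int m) * x) + cos (2 * pi * of_int (int (Suc j) + int m) * x)) / 2" for x
    unfolding cos_times_cos by (simp add: algebra_simps)
  moreover have "((if int (Suc j) - int m = 0 then 1 else 0) + (if int (Suc j) + int m = 0 then 1 else 0)) / 2
    = (if m = Suc j then 1/2 else 0::real)" by auto
  ultimately show ?thesis by (simp only:)
qed

lemma gaussian_periodization_summable:
  fixes t x :: real
  assumes t: "t > 0"
  shows "(\<lambda>k::int. exp (- pi * t * (x + of_int k)\<^sup>2)) summable_on UNIV"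
proof (rule summable_on_int)
  have key: "summable (\<lambda>n. exp (- pi * t * (y + real n)\<^sup>2))" for y
  proof (rule summable_comparison_test_ev)
    show "summable (\<lambda>n. exp (- pi * t * y) * exp (- pi * t) ^ n)"
      using t by (intro summable_mult summable_geometric) auto
    \<comment> \<open>Once y + n is at least 1, its square dominates it, which leaves a geometric
      series.\<close>
    show "\<forall>\<^sub>F n in sequentially. norm (exp (- pi * t * (y + real n)\<^sup>2)) \<le> exp (- pi * t * y) * exp (- pi * t) ^ n"
      using eventually_ge_at_top[of "nat \<lceil>1 - y\<rceil>"]
    proof eventually_elim
      case (elim n)
      then have "1 \<le> y + real n" by linarith
      then have "y + real n \<le> (y + real n)\<^sup>2" by (simp add: power2_eq_square)
      then have "pi * t * (y + real n) \<le> pi * t * (y + real n)\<^sup>2"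
        using t by (intro mult_left_mono) auto
      then show ?case
        unfolding exp_of_nat_mult[symmetric] exp_add[symmetric] by (simp add: algebra_simps)
    qed
  qed
  show "summable (\<lambda>n. exp (- pi * t * (x + of_int (int n))\<^sup>2))"
    using key[of x] by simp
  have "(x + of_int (- int n))\<^sup>2 = (- x + real n)\<^sup>2" for n
    by (simp add: power2_eq_square algebra_simps)
  then show "summable (\<lambda>n. exp (- pi * t * (x + of_int (- int n))\<^sup>2))"
    using key[of "- x"] by simp
qed simp

text \<open>The frequency side of Poisson summation: theta_3 with nome exp(-pi/t) at exp(2 pi i x),
  divided by sqrt t, with opposite frequencies merged into cosines. Index \<open>j\<close> carries
  frequency j+1.\<close>

definition dual_theta :: "real \<Rightarrow> real \<Rightarrow> real" where
  "dual_theta t x = (1 + 2 * (\<Sum>j. exp (- pi * (real (Suc j))\<^sup>2 / t) * cos (2 * pi * real (Suc j) * x))) / sqrt t"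

lemma dual_theta_coeff_le:
  assumes "t > 0"
  shows "\<bar>exp (- pi * (real (Suc j))\<^sup>2 / t) * cos y\<bar> \<le> exp (- pi / t) ^ j"
proof -
  have "real j \<le> (real (Suc j))\<^sup>2" by (simp add: power2_eq_square algebra_simps)
  then have "pi / t * real j \<le> pi / t * (real (Suc j))\<^sup>2"
    using assms by (intro mult_left_mono) auto
  then have "exp (- pi * (real (Suc j))\<^sup>2 / t) \<le> exp (- pi / t) ^ j"
    unfolding exp_of_nat_mult[symmetric] by (simp add: algebra_simps)
  moreover have "\<bar>exp (- pi * (real (Suc j))\<^sup>2 / t) * cos y\<bar> \<le> exp (- pi * (real (Suc j))\<^sup>2 / t) * 1"
    unfolding abs_mult by (intro mult_mono) auto
  ultimately show ?thesis by linarith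
qed

text \<open>Both the symmetric partial sums \<open>G\<close> of the periodization and the partial
  cosine series \<open>D\<close> converge uniformly on the window, so their difference has a
  continuous even limit \<open>h\<close> whose cosine coefficients may be computed in the limit. For
  \<open>G\<close> they unfold to Fourier integrals of the Gaussian, for \<open>D\<close> they can
  be read off; they agree, and uniqueness gives h = 0.\<close>

lemma poisson_gaussian_window:
  fixes t x :: real
  assumes t: "t > 0" and x: "x \<in> {-1/2..1/2}"
  shows "(\<lambda>N. \<Sum>k\<in>{-int N..int N}. exp (- pi * t * (x + of_int k)\<^sup>2)) \<longlonglongrightarrow> dual_theta t x"
proof -
  define g where "g x = exp (- pi * t * x\<^sup>2)" for x :: real
  define c where "c j = exp (- pi * (real (Suc j))\<^sup>2 / t)" for j
  \<comment> \<open>Pairing the shifts by j+1 and -(j+1) makes each term even in \<open>x\<close>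
    and matches the symmetric partial sums.\<close>
  define p where "p j x = g (x + real (Suc j)) + g (x - real (Suc j))" for j x
  define F where "F x = g x + (\<Sum>j. p j x)" for x
  define G where "G N x = (\<Sum>k\<in>{-int N..int N}. g (x + of_int k))" for N x
  define D where "D N x = (1 + 2 * (\<Sum>j<N. c j * cos (2 * pi * real (Suc j) * x))) / sqrt t" for N x
  let ?I = "{-1/2..1/2::real}"
  have G: "G N x = g x + (\<Sum>j<N. p j x)" for N x
    unfolding G_def symmetric_interval_sum p_def
    by (simp only: of_int_minus of_int_of_nat_eq of_int_0 add_0_right add_uminus_conv_diff)
  have cont_g: "continuous_on A g" for A
    unfolding g_def by (intro continuous_intros)
  have cont_G: "continuous_on A (G N)" for A N
    unfolding G_def g_def by (intro continuous_intros)
  have cont_D: "continuous_on A (D N)" for A N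
    unfolding D_def using t by (intro continuous_intros) auto
  have uF: "uniform_limit ?I G F sequentially"
  proof -
    have "uniform_limit ?I (\<lambda>N x. \<Sum>j<N. p j x) (\<lambda>x. \<Sum>j. p j x) sequentially"
    proof (rule Weierstrass_m_test)
      show "summable (\<lambda>j. 2 * exp (- pi * t) ^ j)"
        using t by (intro summable_mult summable_geometric) auto
      fix j and y :: real assume y: "y \<in> ?I"
      have *: "g z \<le> exp (- pi * t) ^ j" if "real j + 1/2 \<le> \<bar>z\<bar>" for z
      proof -
        have "(real j + 1/2)\<^sup>2 \<le> \<bar>z\<bar>\<^sup>2" by (intro power_mono that) auto
        moreover have "real j \<le> (real j + 1/2)\<^sup>2" by (simp add: power2_eq_square algebra_simps)
        ultimately have "pi * t * real j \<le> pi * t * z\<^sup>2"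
          using t by (intro mult_left_mono) auto
        then show ?thesis
          unfolding g_def exp_of_nat_mult[symmetric] by (simp add: algebra_simps)
      qed
      have "g (y + real (Suc j)) \<le> exp (- pi * t) ^ j" "g (y - real (Suc j)) \<le> exp (- pi * t) ^ j"
        using y by (intro *, simp add: abs_if)+
      moreover have "g z \<ge> 0" for z by (simp add: g_def)
      ultimately show "norm (p j y) \<le> 2 * exp (- pi * t) ^ j"
        unfolding p_def real_norm_def by (smt (verit))
    qed
    then show ?thesis
      unfolding F_def G[abs_def] by (intro uniform_limit_intros)
  qed
  have uD: "uniform_limit ?I D (dual_theta t) sequentially"
  proof -
    have "uniform_limit ?I (\<lambda>N x. \<Sum>j<N. c j * cos (2 * pi * real (Suc j) * x))
      (\<lambda>x. \<Sum>j. c j * cos (2 * pi * real (Suc j) * x)) sequentially"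
    proof (rule Weierstrass_m_test)
      show "summable (\<lambda>j. exp (- pi / t) ^ j)"
        using t by (intro summable_geometric) auto
      show "norm (c j * cos (2 * pi * real (Suc j) * y)) \<le> exp (- pi / t) ^ j" for j y
        unfolding c_def real_norm_def by (rule dual_theta_coeff_le[OF t])
    qed
    then have "uniform_limit ?I (\<lambda>N x. inverse (sqrt t) * (1 + 2 * (\<Sum>j<N. c j * cos (2 * pi * real (Suc j) * x))))
      (\<lambda>x. inverse (sqrt t) * (1 + 2 * (\<Sum>j. c j * cos (2 * pi * real (Suc j) * x)))) sequentially"
      by (intro bounded_linear.uniform_limit[OF bounded_linear_mult_right] uniform_limit_intros)
    then show ?thesis
      unfolding D_def dual_theta_def c_def divide_inverse by (simp only: mult.commute)
  qed
  define h where "h x = F x - dual_theta t x" for x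
  have uh: "uniform_limit ?I (\<lambda>N x. G N x - D N x) h sequentially"
    unfolding h_def by (intro uniform_limit_minus uF uD)
  have cont_h: "continuous_on ?I h"
    by (rule uniform_limit_theorem[OF _ uh]) (auto intro!: always_eventually continuous_on_diff cont_G cont_D)
  have even: "h (- y) = h y" for y
  proof -
    have "g (- z) = g z" for z by (simp add: g_def)
    from this[of "y + _"] this[of "y - _"] this have "p j (- y) = p j y" for j
      unfolding p_def by (smt (verit))
    moreover have "g (- y) = g y" by fact
    ultimately show ?thesis
      unfolding h_def F_def dual_theta_def by simp
  qed
  have orth: "integral ?I (\<lambda>x. h x * cos (2 * pi * real m * x)) = 0" for m
  proof -
    have "uniform_limit ?I (\<lambda>N x. (G N x - D N x) * cos (2 * pi * real m * x))
       (\<lambda>x. h x * cos (2 * pi * real m * x)) sequentially"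
      unfolding uniform_limit_iff
    proof safe
      fix e :: real assume "e > 0"
      with uh have "\<forall>\<^sub>F N in sequentially. \<forall>x\<in>?I. dist (G N x - D N x) (h x) < e"
        unfolding uniform_limit_iff by blast
      then show "\<forall>\<^sub>F N in sequentially. \<forall>x\<in>?I.
        dist ((G N x - D N x) * cos (2 * pi * real m * x)) (h x * cos (2 * pi * real m * x)) < e"
      proof eventually_elim
        case (elim N)
        show ?case
        proof
          fix x assume "x \<in> ?I"
          with elim have "\<bar>G N x - D N x - h x\<bar> < e" by (simp add: dist_real_def)
          moreover have "\<bar>G N x - D N x - h x\<bar> * \<bar>cos (2 * pi * real m * x)\<bar> \<le> \<bar>G N x - D N x - h x\<bar> * 1"
            by (intro mult_left_mono) auto
          ultimately show "dist ((G N x - D N x) * cos (2 * pi * real m * x)) (h x * cos (2 * pi * real m * x)) < e"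
            unfolding dist_real_def left_diff_distrib[symmetric] abs_mult by simp
        qed
      qed
    qed
    then obtain I J where
      I: "\<And>N. ((\<lambda>x. (G N x - D N x) * cos (2 * pi * real m * x)) has_integral I N) ?I" and
      J: "((\<lambda>x. h x * cos (2 * pi * real m * x)) has_integral J) ?I" and IJ: "I \<longlonglongrightarrow> J"
      by (rule uniform_limit_integral)
         (auto intro!: continuous_on_mult continuous_on_diff cont_G cont_D continuous_intros)
    let ?V = "exp (- pi * (real m)\<^sup>2 / t) / sqrt t"
    define A where "A N = integral {-(real N + 1/2)..real N + 1/2} (\<lambda>x. g x * cos (2 * pi * real m * x))" for N
    have A: "A \<longlonglongrightarrow> ?V"
      unfolding A_def g_def by (intro has_bochner_integral_symmetric_limit gaussian_cos_integral t)
    \<comment> \<open>A cosine of integer frequency is unchanged by integer shifts, so multiplying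
      by it commutes with periodization.\<close>
    have intG: "((\<lambda>x. G N x * cos (2 * pi * real m * x)) has_integral A N) ?I" for N
    proof -
      have "((\<lambda>x. \<Sum>k\<in>{-int N..int N}. g (x + of_int k) * cos (2 * pi * real m * (x + of_int k))) has_integral A N) ?I"
        unfolding A_def by (rule integral_periodization) (intro continuous_on_mult cont_g continuous_intros)
      moreover have "cos (2 * pi * real m * (x + of_int k)) = cos (2 * pi * real m * x)" for x k
      proof -
        have "cos (2 * pi * real m * (x + of_int k)) = cos (2 * pi * real m * x + 2 * pi * of_int (int m * k))"
          by (simp add: algebra_simps)
        also have "\<dots> = cos (2 * pi * real m * x)"
          by (simp only: cos_add cos_int_2pin sin_int_2pin mult_1_right mult_zero_right diff_zero)
        finally show ?thesis .
      qed
      ultimately show ?thesis unfolding G_def sum_distrib_right by simp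
    qed
    have intD: "((\<lambda>x. D N x * cos (2 * pi * real m * x)) has_integral
        ((if m = 0 then 1 else 0) + 2 * (\<Sum>j<N. c j * (if m = Suc j then 1/2 else 0))) * inverse (sqrt t)) ?I" for N
    proof -
      have "((\<lambda>x. (cos (2 * pi * of_int (int m) * x) + 2 * (\<Sum>j<N. c j * (cos (2 * pi * real (Suc j) * x) * cos (2 * pi * real m * x)))) * inverse (sqrt t)) has_integral
        ((if int m = 0 then 1 else 0) + 2 * (\<Sum>j<N. c j * (if m = Suc j then 1/2 else 0))) * inverse (sqrt t)) ?I"
        by (intro has_integral_mult_left has_integral_add has_integral_mult_right has_integral_sum
              has_integral_cos_period has_integral_cos_cos) auto
      moreover have "D N x * cos (2 * pi * real m * x) = (cos (2 * pi * of_int (int m) * x) + 2 * (\<Sum>j<N. c j * (cos (2 * pi * real (Suc j) * x) * cos (2 * pi * real m * x)))) * inverse (sqrt t)" for x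
        unfolding D_def divide_inverse of_int_of_nat_eq by (simp only: sum_distrib_left sum_distrib_right distrib_right distrib_left mult_1_right mult_1_left mult_ac)
      ultimately show ?thesis by simp
    qed
    define B where "B N = ((if m = 0 then 1 else 0) + 2 * (\<Sum>j<N. c j * (if m = Suc j then 1/2 else 0))) * inverse (sqrt t)" for N
    have IAB: "I N = A N - B N" for N
      using has_integral_diff[OF intG[of N] intD[of N, folded B_def]]
      unfolding left_diff_distrib[symmetric] by (rule has_integral_unique[OF I])
    \<comment> \<open>The truncated series has its final coefficient at frequency \<open>m\<close>
      as soon as it includes the index m-1.\<close>
    have B: "B N = ?V" if N: "m \<le> N" for N
    proof (cases m)
      case 0
      then show ?thesis by (simp add: divide_inverse B_def)
    next
      case (Suc m')
      have "(\<Sum>j<N. c j * (if m = Suc j then 1/2 else 0)) = (\<Sum>j<N. if j = m' then c j / 2 else 0)"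
        by (intro sum.cong) (auto simp: Suc)
      also have "\<dots> = c m' / 2" using N Suc by simp
      finally have sum: "(\<Sum>j<N. c j * (if m = Suc j then 1/2 else 0)) = c m' / 2" .
      have "m \<noteq> 0" by (simp add: Suc)
      then have "B N = c m' * inverse (sqrt t)" unfolding B_def sum by simp
      also have "\<dots> = ?V" unfolding c_def Suc divide_inverse ..
      finally show ?thesis .
    qed
    have "\<forall>\<^sub>F N in sequentially. A N - ?V = I N"
      using eventually_ge_at_top[of m] by eventually_elim (simp only: IAB B)
    moreover have "(\<lambda>N. A N - ?V) \<longlonglongrightarrow> ?V - ?V" by (intro tendsto_intros A)
    ultimately have "I \<longlonglongrightarrow> ?V - ?V" by (rule Lim_transform_eventually[rotated])
    then have "J = 0" using LIMSEQ_unique[OF IJ] by simp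
    with J show ?thesis by (simp add: integral_unique)
  qed
  have "h x = 0" by (rule even_cosine_uniqueness[OF cont_h even orth x])
  moreover have "(\<lambda>N. G N x) \<longlonglongrightarrow> F x" by (rule tendsto_uniform_limitI[OF uF x])
  ultimately show ?thesis unfolding h_def G_def g_def by simp
qed

lemma dual_theta_periodic: "dual_theta t (x + of_int k) = dual_theta t x"
proof -
  have "cos (2 * pi * real (Suc j) * (x + of_int k)) = cos (2 * pi * real (Suc j) * x)" for j
  proof -
    have "cos (2 * pi * real (Suc j) * (x + of_int k)) = cos (2 * pi * real (Suc j) * x + 2 * pi * of_int (int (Suc j) * k))"
      by (simp add: algebra_simps)
    also have "\<dots> = cos (2 * pi * real (Suc j) * x)"
      by (simp only: cos_add cos_int_2pin sin_int_2pin mult_1_right mult_zero_right diff_zero)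
    finally show ?thesis .
  qed
  then show ?thesis unfolding dual_theta_def by simp
qed

text \<open>Both sides have period 1 in \<open>x\<close>, so subtracting \<open>round x\<close>
  moves the point into the window. Absolute summability turns the symmetric limit into an unordered
  sum.\<close>

lemma poisson_gaussian:
  fixes t x :: real
  assumes t: "t > 0"
  shows "((\<lambda>k::int. exp (- pi * t * (x + of_int k)\<^sup>2)) has_sum dual_theta t x) UNIV"
proof -
  let ?g = "\<lambda>y k::int. exp (- pi * t * (y + of_int k)\<^sup>2)"
  define y where "y = x - of_int (round x)"
  have y: "y \<in> {-1/2..1/2}"
    unfolding y_def using of_int_round_abs_le[of x] by (simp add: abs_if split: if_splits)
  obtain S where S: "(?g y has_sum S) UNIV"
    using gaussian_periodization_summable[OF t, of y] unfolding summable_on_def by blast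
  have "S = dual_theta t y"
    using has_sum_int_imp_tendsto[OF S] poisson_gaussian_window[OF t y] by (rule LIMSEQ_unique)
  moreover have "dual_theta t x = dual_theta t y"
    using dual_theta_periodic[of t y "round x"] by (simp add: y_def)
  moreover have "((\<lambda>k. ?g y (k + round x)) has_sum S) UNIV"
    by (subst has_sum_reindex_bij_witness[where j = "\<lambda>k. k + round x" and i = "\<lambda>k. k - round x" and T = UNIV and h = "?g y" and s' = S])
       (use S in auto)
  moreover have "?g y (k + round x) = ?g x k" for k
    by (simp add: y_def)
  ultimately show ?thesis by (simp only:)
qed

section \<open>The pentagonal number theorem\<close>

text \<open>Weierstrass's product inequality, the source of the lower bounds for Pochhammer
  tails.\<close>

lemma one_minus_sum_le_prod:
  fixes x :: "'a \<Rightarrow> real"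
  assumes "\<And>i. i \<in> A \<Longrightarrow> 0 \<le> x i \<and> x i \<le> 1"
  shows "1 - (\<Sum>i\<in>A. x i) \<le> (\<Prod>i\<in>A. 1 - x i)"
  using assms
proof (induction A rule: infinite_finite_induct)
  case (insert a A)
  have le1: "(\<Prod>i\<in>A. 1 - x i) \<le> 1" using insert by (intro prod_le_1) auto
  have "x a * (\<Prod>i\<in>A. 1 - x i) \<le> x a * 1"
    using insert le1 by (intro mult_left_mono) auto
  then show ?case using insert by (simp add: algebra_simps)
qed auto

section \<open>Positivity, convergence and tails of q-Pochhammer products\<close>

context
  fixes q c :: real
  assumes q: "0 < q" "q < 1" and c: "0 < c" "c < 1"
begin

lemma qpoch_factor: "0 < c * q ^ k" "c * q ^ k < 1"
proof -
  have "q ^ k \<le> 1" using q by (intro power_le_one) auto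
  then have "c * q ^ k \<le> c * 1" using c by (intro mult_left_mono) auto
  then show "c * q ^ k < 1" using c by linarith
qed (use q c in simp)

lemma qpoch_pos: "qpoch c q k > 0"
  unfolding qpoch_def using qpoch_factor by (intro prod_pos) simp

lemma qpoch_convergent_prod: "convergent_prod (\<lambda>k. 1 - c * q ^ k)"
proof (intro abs_convergent_prod_imp_convergent_prod summable_imp_abs_convergent_prod)
  show "summable (\<lambda>k. norm (1 - c * q ^ k - 1))"
    using q by (simp add: abs_mult power_abs summable_mult summable_geometric)
qed

lemma qpoch_LIMSEQ: "qpoch c q \<longlonglongrightarrow> qpoch_inf c q"
proof -
  have "(\<lambda>n. \<Prod>i<n. 1 - c * q ^ i) \<longlonglongrightarrow> qpoch_inf c q"
    unfolding qpoch_inf_def LIMSEQ_lessThan_iff_atMost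
    by (rule convergent_prod_LIMSEQ[OF qpoch_convergent_prod])
  then show ?thesis unfolding qpoch_def[abs_def] .
qed

lemma qpoch_inf_pos: "qpoch_inf c q > 0"
proof -
  have "qpoch_inf c q \<noteq> 0"
    unfolding qpoch_inf_def
    using qpoch_convergent_prod qpoch_factor(2) by (intro prodinf_nonzero) (auto simp: less_imp_neq)
  moreover have "qpoch_inf c q \<ge> 0"
    using qpoch_LIMSEQ by (rule LIMSEQ_le_const) (use qpoch_pos less_imp_le in blast)
  ultimately show ?thesis by simp
qed

text \<open>The quotient is the product of the factors from index \<open>k\<close> on. Each factor
  lies in (0,1), and the amounts subtracted from 1 form a geometric series with sum c
  q^k/(1-q).\<close>

lemma qpoch_tail:
  "qpoch_inf c q / qpoch c q k \<le> 1" "1 - c * q ^ k / (1 - q) \<le> qpoch_inf c q / qpoch c q k"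
proof -
  have split: "qpoch c q (n + k) / qpoch c q k = (\<Prod>i<n. 1 - c * q ^ (i + k))" for n
  proof (induction n)
    case 0
    then show ?case using qpoch_pos[of k] by simp
  next
    case (Suc n)
    have "qpoch c q (Suc n + k) = qpoch c q (n + k) * (1 - c * q ^ (n + k))"
      by (simp add: qpoch_def)
    then show ?case
      unfolding prod.lessThan_Suc Suc[symmetric] by (simp only: times_divide_eq_left)
  qed
  have lim: "(\<lambda>n. qpoch c q (n + k) / qpoch c q k) \<longlonglongrightarrow> qpoch_inf c q / qpoch c q k"
    by (rule tendsto_divide[OF LIMSEQ_ignore_initial_segment[OF qpoch_LIMSEQ] tendsto_const])
       (use qpoch_pos[of k] in simp)
  have "(\<Prod>i<n. 1 - c * q ^ (i + k)) \<le> 1" for n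
    using qpoch_factor by (intro prod_le_1) (auto simp: less_imp_le)
  then show "qpoch_inf c q / qpoch c q k \<le> 1"
    by (intro LIMSEQ_le_const2[OF lim]) (simp add: split)
  have "1 - c * q ^ k / (1 - q) \<le> (\<Prod>i<n. 1 - c * q ^ (i + k))" for n
  proof -
    have "(\<Sum>i<n. c * q ^ (i + k)) = c * q ^ k * (\<Sum>i<n. q ^ i)"
      by (simp add: sum_distrib_left power_add mult_ac)
    also have "\<dots> \<le> c * q ^ k * (1 / (1 - q))"
    proof (intro mult_left_mono)
      show "(\<Sum>i<n. q ^ i) \<le> 1 / (1 - q)"
        using q by (simp add: sum_gp_strict divide_right_mono)
    qed (use q c in simp)
    finally have "1 - c * q ^ k / (1 - q) \<le> 1 - (\<Sum>i<n. c * q ^ (i + k))" by simp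
    also have "\<dots> \<le> (\<Prod>i<n. 1 - c * q ^ (i + k))"
      by (rule one_minus_sum_le_prod) (use qpoch_factor less_imp_le in blast)
    finally show ?thesis .
  qed
  then show "1 - c * q ^ k / (1 - q) \<le> qpoch_inf c q / qpoch c q k"
    by (intro LIMSEQ_le_const[OF lim]) (simp add: split)
qed

end

text \<open>The pentagonal number theorem, after Shanks: the sums over \<open>k\<close> of these terms are, up to a
  vanishing error, both the finite products and the partial sums of the pentagonal series.\<close>

definition shanks :: "real \<Rightarrow> nat \<Rightarrow> nat \<Rightarrow> real" where
  "shanks q n k = (-1) ^ k * (qpoch q q n / qpoch q q k) * q ^ (k * n + k * (k + 1) div 2)"

text \<open>With k = j+1 the two exponents are the pentagonal numbers k(3k-1)/2 and k(3k+1)/2.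
  Passing from n to n+1 changes the old summands by a telescoping amount, which produces the first
  of the two new powers; the new last summand is the second.\<close>

lemma shanks_identity:
  fixes q :: real
  assumes q: "0 < q" "q < 1"
  shows "(\<Sum>k\<le>n. shanks q n k) =
    1 + (\<Sum>j<n. (-1) ^ Suc j * (q ^ (Suc j * (3 * j + 2) div 2) + q ^ (Suc j * (3 * j + 4) div 2)))"
proof (induction n)
  case 0
  then show ?case by (simp add: shanks_def qpoch_def)
next
  case (Suc n)
  have P: "qpoch q q k \<noteq> 0" for k using qpoch_pos[OF q q, of k] by simp
  have PS: "qpoch q q (Suc k) = qpoch q q k * (1 - q ^ Suc k)" for k by (simp add: qpoch_def)
  have T: "Suc k * (Suc k + 1) div 2 = k * (k + 1) div 2 + Suc k" for k
  proof -
    have "Suc k * (Suc k + 1) = k * (k + 1) + 2 * Suc k" by simp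
    then show ?thesis by simp
  qed
  \<comment> \<open>The partial sums of the differences have a closed form, which at m = n collapses
    to a signed power of \<open>q\<close>.\<close>
  have step: "(\<Sum>k\<le>m. shanks q (Suc n) k - shanks q n k) =
     (-1) ^ Suc m * (qpoch q q n / qpoch q q m) * q ^ ((m + 1) * n + (Suc m) * (Suc m + 1) div 2)" for m
  proof (induction m)
    case 0
    have "qpoch q q (Suc n) - qpoch q q n = - qpoch q q n * q ^ Suc n"
      unfolding PS by (simp add: algebra_simps)
    then show ?case by (simp add: shanks_def qpoch_def)
  next
    case (Suc m)
    define a where "a = q ^ ((m + 1) * n + (Suc m) * (Suc m + 1) div 2)"
    define r where "r = qpoch q q n / qpoch q q (Suc m)"
    have r: "qpoch q q n / qpoch q q m = r * (1 - q ^ Suc m)"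
      using P[of m] P[of "Suc m"] by (simp add: r_def PS field_simps)
    have e1: "q ^ (Suc m * Suc n + Suc m * (Suc m + 1) div 2) = a * q ^ Suc m"
      unfolding a_def power_add[symmetric] by (simp add: algebra_simps)
    have e2: "q ^ (Suc m * n + Suc m * (Suc m + 1) div 2) = a"
      unfolding a_def by simp
    have e3: "q ^ ((Suc m + 1) * n + Suc (Suc m) * (Suc (Suc m) + 1) div 2) = a * q ^ n * q ^ Suc (Suc m)"
      unfolding a_def power_add[symmetric] T[of "Suc m"] by (simp add: algebra_simps)
    have "qpoch q q (Suc n) / qpoch q q (Suc m) = r * (1 - q ^ Suc n)"
      unfolding r_def PS[of n] by simp
    then have "shanks q (Suc n) (Suc m) - shanks q n (Suc m)
       = (-1) ^ Suc m * r * (1 - q ^ Suc n) * (a * q ^ Suc m) - (-1) ^ Suc m * r * a"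
      unfolding shanks_def e1 e2 r_def[symmetric] by (simp only: mult.assoc)
    then have "(\<Sum>k\<le>Suc m. shanks q (Suc n) k - shanks q n k)
      = (-1) ^ Suc m * (r * (1 - q ^ Suc m)) * a
       + ((-1) ^ Suc m * r * (1 - q ^ Suc n) * (a * q ^ Suc m) - (-1) ^ Suc m * r * a)"
      unfolding sum.atMost_Suc Suc.IH r a_def by simp
    also have "\<dots> = (-1) ^ Suc (Suc m) * r * (a * q ^ n * q ^ Suc (Suc m))"
      by (simp add: algebra_simps)
    finally show ?case unfolding e3 r_def .
  qed
  \<comment> \<open>A product of consecutive integers is even, so the truncating division is
    exact.\<close>
  have half: "2 * (k * (k + 1) div 2) = k * (k + 1)" for k :: nat
    by (cases "even k") auto
  have "(\<Sum>k\<le>Suc n. shanks q (Suc n) k)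
     = (\<Sum>k\<le>n. shanks q n k) + (\<Sum>k\<le>n. shanks q (Suc n) k - shanks q n k) + shanks q (Suc n) (Suc n)"
    by (simp add: sum_subtractf)
  also have "(\<Sum>k\<le>n. shanks q (Suc n) k - shanks q n k) = (-1) ^ Suc n * q ^ (Suc n * (3 * n + 2) div 2)"
  proof -
    have "(n + 1) * n + (Suc n) * (Suc n + 1) div 2 = Suc n * (3 * n + 2) div 2"
      using half[of "Suc n"] by (simp add: algebra_simps)
    then show ?thesis unfolding step using P[of n] by simp
  qed
  also have "shanks q (Suc n) (Suc n) = (-1) ^ Suc n * q ^ (Suc n * (3 * n + 4) div 2)"
  proof -
    have "Suc n * Suc n + Suc n * (Suc n + 1) div 2 = Suc n * (3 * n + 4) div 2"
      using half[of "Suc n"] by (simp add: algebra_simps)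
    then show ?thesis unfolding shanks_def using P[of "Suc n"] by simp
  qed
  finally show ?case unfolding Suc.IH by (simp add: distrib_left)
qed

text \<open>The summand at k = 0 is the finite product itself. Every other summand carries a factor
  q^(kn), so together they are at most n q^n divided by the Euler product, which tends to 0.\<close>

lemma pentagonal_limit:
  fixes q :: real
  assumes q: "0 < q" "q < 1"
  shows "(\<lambda>n. 1 + (\<Sum>j<n. (-1) ^ Suc j * (q ^ (Suc j * (3 * j + 2) div 2) + q ^ (Suc j * (3 * j + 4) div 2))))
     \<longlonglongrightarrow> qpoch_inf q q"
proof -
  define err where "err n = (\<Sum>k\<in>{1..n}. shanks q n k)" for n
  have le: "\<bar>err n\<bar> \<le> real n * q ^ n / qpoch_inf q q" for n
  proof -
    have "\<bar>shanks q n k\<bar> \<le> q ^ n / qpoch_inf q q" if k: "k \<in> {1..n}" for k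
    proof -
      have pos: "qpoch q q m > 0" for m by (rule qpoch_pos[OF q q])
      have inf: "qpoch_inf q q > 0" by (rule qpoch_inf_pos[OF q q])
      have n1: "qpoch q q n \<le> 1"
        unfolding qpoch_def using qpoch_factor[OF q q] by (intro prod_le_1) (auto simp: less_imp_le)
      have "qpoch_inf q q \<le> qpoch q q k" using qpoch_tail(1)[OF q q, of k] pos[of k] by simp
      then have 1: "qpoch q q n / qpoch q q k \<le> 1 / qpoch_inf q q"
        using pos[of k] pos[of n] inf n1 by (intro frac_le) auto
      have "n \<le> k * n" using k by (cases k) auto
      then have 2: "q ^ (k * n + k * (k + 1) div 2) \<le> q ^ n"
        using q by (intro power_decreasing) linarith+
      have "\<bar>shanks q n k\<bar> = qpoch q q n / qpoch q q k * q ^ (k * n + k * (k + 1) div 2)"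
        unfolding shanks_def using pos[of n] pos[of k] q by (simp add: abs_mult power_abs)
      also have "\<dots> \<le> 1 / qpoch_inf q q * q ^ n"
        using q pos[of n] pos[of k] inf by (intro mult_mono 1 2) auto
      finally show ?thesis by simp
    qed
    then have "\<bar>err n\<bar> \<le> (\<Sum>k\<in>{1..n}. q ^ n / qpoch_inf q q)"
      unfolding err_def by (intro order_trans[OF sum_abs] sum_mono)
    then show ?thesis by simp
  qed
  have "(\<lambda>n. real n * q ^ n / qpoch_inf q q) \<longlonglongrightarrow> 0 / qpoch_inf q q"
    using q by (intro tendsto_intros powser_times_n_limit_0) (use qpoch_inf_pos[OF q q] in auto)
  then have "err \<longlonglongrightarrow> 0"
    by (intro Lim_null_comparison[of err]) (use le in auto)
  then have "(\<lambda>n. qpoch q q n + err n) \<longlonglongrightarrow> qpoch_inf q q + 0"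
    by (intro tendsto_add qpoch_LIMSEQ[OF q q])
  moreover have "qpoch q q n + err n = (\<Sum>k\<le>n. shanks q n k)" for n
  proof -
    have "{..n} = insert 0 {1..n}" by auto
    then show ?thesis unfolding err_def by (simp add: shanks_def qpoch_def[of _ _ 0])
  qed
  ultimately show ?thesis unfolding shanks_identity[OF q, symmetric] by simp
qed

section \<open>Asymptotics of theta functions and of the Euler product\<close>

text \<open>The dual series of the alternating Gaussian sum, of theta_2 type: the signs (-1)^k shift
  the frequencies to j + 1/2, which are written here as (2j+1)/2.\<close>

definition odd_theta :: "real \<Rightarrow> real \<Rightarrow> real" where
  "odd_theta t x = 2 * (\<Sum>j. exp (- pi * (2 * real j + 1)\<^sup>2 / (4 * t)) * cos (pi * (2 * real j + 1) * x)) / sqrt t"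

lemma summable_dual_theta:
  assumes "t > 0"
  shows "summable (\<lambda>j. exp (- pi * (real (Suc j))\<^sup>2 / t) * cos (y j))"
proof (rule summable_comparison_test[OF exI[of _ 0]])
  show "summable (\<lambda>j. exp (- pi / t) ^ j)"
    using assms by (intro summable_geometric) auto
  show "\<forall>j\<ge>0. norm (exp (- pi * (real (Suc j))\<^sup>2 / t) * cos (y j)) \<le> exp (- pi / t) ^ j"
    using dual_theta_coeff_le[OF assms] by (simp only: real_norm_def) blast
qed

text \<open>At (4t, x/2) the dual series runs over all half-integer multiples of the frequency. The
  even multiples rebuild the series at (t, x), and the odd ones remain. The factor 2 compensates
  sqrt(4t) = 2 sqrt t.\<close>

lemma dual_theta_diff_eq_odd_theta:
  assumes t: "t > 0"
  shows "2 * dual_theta (4 * t) (x / 2) - dual_theta t x = odd_theta t x"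
    "summable (\<lambda>j. exp (- pi * (2 * real j + 1)\<^sup>2 / (4 * t)) * cos (pi * (2 * real j + 1) * x))"
proof -
  define a where "a m = exp (- pi * (real (Suc m))\<^sup>2 / (4 * t)) * cos (2 * pi * real (Suc m) * (x / 2))" for m
  have suma: "summable a"
    unfolding a_def using t by (intro summable_dual_theta) simp
  \<comment> \<open>Index \<open>m\<close> of \<open>a\<close> belongs to frequency m+1, so odd
    indices carry the even frequencies.\<close>
  have odd: "a (2 * j + 1) = exp (- pi * (real (Suc j))\<^sup>2 / t) * cos (2 * pi * real (Suc j) * x)" for j
  proof -
    have 1: "real (Suc (2 * j + 1)) = 2 * real (Suc j)" by simp
    have 2: "- pi * (2 * real (Suc j))\<^sup>2 / (4 * t) = - pi * (real (Suc j))\<^sup>2 / t"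
      unfolding power_mult_distrib by simp
    have 3: "2 * pi * (2 * real (Suc j)) * (x / 2) = 2 * pi * real (Suc j) * x" by simp
    show ?thesis unfolding a_def 1 2 3 ..
  qed
  have even: "a (2 * j) = exp (- pi * (2 * real j + 1)\<^sup>2 / (4 * t)) * cos (pi * (2 * real j + 1) * x)" for j
  proof -
    have 1: "real (Suc (2 * j)) = 2 * real j + 1" by simp
    have 3: "2 * pi * (2 * real j + 1) * (x / 2) = pi * (2 * real j + 1) * x" by simp
    show ?thesis unfolding a_def 1 3 ..
  qed
  have pair: "(\<lambda>j. a (2 * j) + a (2 * j + 1)) sums suminf a"
  proof -
    have "{n * 2..<n * 2 + 2} = {2 * n, 2 * n + 1}" for n :: nat by auto
    then show ?thesis using sums_group[OF summable_sums[OF suma], of 2] by simp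
  qed
  have sodd: "(\<lambda>j. a (2 * j + 1)) sums (\<Sum>j. a (2 * j + 1))"
    unfolding odd by (intro summable_sums summable_dual_theta t)
  have seven: "(\<lambda>j. a (2 * j)) sums (suminf a - (\<Sum>j. a (2 * j + 1)))"
    using sums_diff[OF pair sodd] by simp
  then show "summable (\<lambda>j. exp (- pi * (2 * real j + 1)\<^sup>2 / (4 * t)) * cos (pi * (2 * real j + 1) * x))"
    unfolding even by (rule sums_summable)
  have sq: "sqrt (4 * t) = 2 * sqrt t" by (simp add: real_sqrt_mult)
  have "2 * (X / (2 * r)) = X / r" for X r :: real by simp
  then have "2 * dual_theta (4 * t) (x / 2) = (1 + 2 * suminf a) / sqrt t"
    unfolding dual_theta_def sq a_def .
  moreover have "dual_theta t x = (1 + 2 * (\<Sum>j. a (2 * j + 1))) / sqrt t"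
    unfolding dual_theta_def odd ..
  moreover have "odd_theta t x = 2 * (suminf a - (\<Sum>j. a (2 * j + 1))) / sqrt t"
    unfolding odd_theta_def even[symmetric] sums_unique[OF seven] ..
  ultimately show "2 * dual_theta (4 * t) (x / 2) - dual_theta t x = odd_theta t x"
    by (simp only: diff_divide_distrib[symmetric]) (simp add: algebra_simps)
qed

text \<open>The sign is twice the indicator of the even integers minus 1, and the Gaussian sum over
  even integers is a full one with parameter 4t at x/2.\<close>

lemma poisson_gaussian_alternating:
  fixes t x :: real
  assumes t: "t > 0"
  shows "((\<lambda>k::int. (-1) powi k * exp (- pi * t * (x + of_int k)\<^sup>2)) has_sum odd_theta t x) UNIV"
proof -
  let ?g = "\<lambda>k::int. exp (- pi * t * (x + of_int k)\<^sup>2)"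
  have "((\<lambda>k::int. ?g (2 * k)) has_sum dual_theta (4 * t) (x / 2)) UNIV"
  proof -
    have "- pi * (4 * t) * (x / 2 + of_int k)\<^sup>2 = - pi * t * (x + of_int (2 * k))\<^sup>2" for k
      by (simp add: power2_eq_square algebra_simps)
    then show ?thesis using poisson_gaussian[of "4 * t" "x / 2"] t by (simp only:)
  qed
  then have "(?g has_sum dual_theta (4 * t) (x / 2)) (range (\<lambda>k. 2 * k))"
    by (subst has_sum_reindex) (auto simp: inj_on_def o_def)
  then have "((\<lambda>k. if even k then ?g k else 0) has_sum dual_theta (4 * t) (x / 2)) UNIV"
    by (rule has_sum_cong_neutral[THEN iffD1, rotated -1]) auto
  then have "((\<lambda>k. 2 * (if even k then ?g k else 0) + (-1) * ?g k) has_sum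
      (2 * dual_theta (4 * t) (x / 2) + (-1) * dual_theta t x)) UNIV"
    by (intro has_sum_add has_sum_cmult_right poisson_gaussian t)
  moreover have "2 * (if even k then ?g k else 0) + (-1) * ?g k = (-1) powi k * ?g k" for k
    by (simp add: power_int_minus_left)
  moreover have "2 * dual_theta (4 * t) (x / 2) + (-1) * dual_theta t x = odd_theta t x"
    using dual_theta_diff_eq_odd_theta(1)[OF t, of x] by simp
  ultimately show ?thesis by (simp only:)
qed

lemma gaussian_complete_square:
  fixes t u :: real
  assumes "t > 0"
  shows "exp (- pi * t) powi (k ^ 2) * exp (- 2 * pi * u) powi k
     = exp (pi * u\<^sup>2 / t) * exp (- pi * t * (u / t + of_int k)\<^sup>2)"
  unfolding exp_power_int exp_add[symmetric]
  using assms by (simp add: field_simps power2_eq_square)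

lemma theta3_exp:
  assumes t: "t > 0"
  shows "theta3 (exp (- 2 * pi * u)) (exp (- pi * t)) = exp (pi * u\<^sup>2 / t) * dual_theta t (u / t)"
  unfolding theta3_def of_real_eq_id id_apply gaussian_complete_square[OF t]
  by (intro infsumI has_sum_cmult_right poisson_gaussian t)

lemma theta4_exp:
  assumes t: "t > 0"
  shows "theta4 (complex_of_real (exp (- 2 * pi * u))) (exp (- pi * t))
    = of_real (exp (pi * u\<^sup>2 / t) * odd_theta t (u / t))"
proof -
  have "(-1) powi k * complex_of_real (exp (- pi * t) powi (k ^ 2)) * complex_of_real (exp (- 2 * pi * u)) powi k
    = of_real (exp (pi * u\<^sup>2 / t) * ((-1) powi k * exp (- pi * t * (u / t + of_int k)\<^sup>2)))" for k
  proof -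
    have "(-1) powi k * complex_of_real (exp (- pi * t) powi (k ^ 2)) * complex_of_real (exp (- 2 * pi * u)) powi k
      = of_real ((-1) powi k * (exp (- pi * t) powi (k ^ 2) * exp (- 2 * pi * u) powi k))"
      by (simp only: of_real_mult of_real_power_int of_real_minus of_real_1 mult.assoc)
    then show ?thesis unfolding gaussian_complete_square[OF t] by (simp only: mult.left_commute)
  qed
  then show ?thesis
    unfolding theta4_def
    by (simp only:) (intro infsumI has_sum_of_real has_sum_cmult_right poisson_gaussian_alternating t)
qed

text \<open>A negative argument cancels the alternating signs, so the ordinary dual series
  appears.\<close>

lemma theta4_neg_exp:
  assumes t: "t > 0"
  shows "theta4 (- complex_of_real (exp (- 2 * pi * u))) (exp (- pi * t))
    = of_real (exp (pi * u\<^sup>2 / t) * dual_theta t (u / t))"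
proof -
  have "(-1) powi k * complex_of_real (exp (- pi * t) powi (k ^ 2)) * (- complex_of_real (exp (- 2 * pi * u))) powi k
    = of_real (exp (pi * u\<^sup>2 / t) * exp (- pi * t * (u / t + of_int k)\<^sup>2))" for k
  proof -
    have "(-1) powi k * complex_of_real (exp (- pi * t) powi (k ^ 2)) * (- complex_of_real (exp (- 2 * pi * u))) powi k
      = of_real (exp (- pi * t) powi (k ^ 2) * exp (- 2 * pi * u) powi k)"
      unfolding power_int_minus_left[of 1] power_int_minus_left[of "complex_of_real _"]
      by (simp only: of_real_mult of_real_power_int) simp
    then show ?thesis unfolding gaussian_complete_square[OF t] .
  qed
  then show ?thesis
    unfolding theta4_def
    by (simp only:) (intro infsumI has_sum_of_real has_sum_cmult_right poisson_gaussian t)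
qed

text \<open>Completing the square in the pentagonal exponent, k(3k+1)/2 = (3/2)(k+1/6)^2 - 1/24,
  yields the parameter 3t/2, the point 1/6 and the prefactor. In substance this is the modular
  transformation of the eta function.\<close>

lemma qpoch_inf_eq_odd_theta:
  assumes t: "t > 0"
  shows "qpoch_inf (exp (- pi * t)) (exp (- pi * t)) = exp (pi * t / 24) * odd_theta (3 * t / 2) (1 / 6)"
proof -
  let ?q = "exp (- pi * t)"
  let ?f = "\<lambda>k::int. exp (pi * t / 24) * ((-1) powi k * exp (- pi * (3 * t / 2) * (1 / 6 + of_int k)\<^sup>2))"
  have q: "0 < ?q" "?q < 1" using t by auto
  have "(?f has_sum exp (pi * t / 24) * odd_theta (3 * t / 2) (1 / 6)) UNIV"
    using t by (intro has_sum_cmult_right poisson_gaussian_alternating) simp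
  from has_sum_int_imp_tendsto[OF this]
  have lim: "(\<lambda>N. ?f 0 + (\<Sum>j<N. ?f (int (Suc j)) + ?f (- int (Suc j)))) \<longlonglongrightarrow> exp (pi * t / 24) * odd_theta (3 * t / 2) (1 / 6)"
    unfolding symmetric_interval_sum .
  have sq: "exp (pi * t / 24) * exp (- pi * (3 * t / 2) * (1 / 6 + y)\<^sup>2) = exp (- pi * t * (y * (3 * y + 1) / 2))" for y
    unfolding exp_add[symmetric] by (simp add: power2_eq_square field_simps)
  have f: "?f k = (-1) powi k * exp (- pi * t * (of_int k * (3 * of_int k + 1) / 2))" for k
    unfolding mult.left_commute[of "exp _" "(-1) powi k"] sq ..
  have half: "real (m div 2) = real m / 2" if "even m" for m
    using that by (simp add: real_of_nat_div)
  have pow: "?q ^ (m div 2) = exp (- pi * t * (real m / 2))" if "even m" for m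
    unfolding exp_of_nat_mult[symmetric] half[OF that] by (simp add: mult_ac)
  \<comment> \<open>The index j+1 gives the larger pentagonal exponent and -(j+1) the smaller one,
    so the two appear in reversed order.\<close>
  have "?f (int (Suc j)) + ?f (- int (Suc j)) =
    (-1) ^ Suc j * (?q ^ (Suc j * (3 * j + 2) div 2) + ?q ^ (Suc j * (3 * j + 4) div 2))" for j
  proof -
    have ev: "even (Suc j * (3 * j + 2))" "even (Suc j * (3 * j + 4))" by (cases "even j"; simp)+
    have sg: "(-1::real) powi int (Suc j) = (-1) ^ Suc j" "(-1::real) powi (- int (Suc j)) = (-1) ^ Suc j"
      by (simp_all only: power_int_of_nat power_int_minus power_inverse[symmetric]) simp_all
    have e1: "of_int (int (Suc j)) * (3 * of_int (int (Suc j)) + 1) / 2 = real (Suc j * (3 * j + 4)) / 2"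
      by (simp add: algebra_simps)
    have e2: "of_int (- int (Suc j)) * (3 * of_int (- int (Suc j)) + 1) / 2 = real (Suc j * (3 * j + 2)) / 2"
      by (simp add: algebra_simps)
    show ?thesis
      unfolding f unfolding pow[OF ev(1)] pow[OF ev(2)] sg e1 e2
      by (rule trans[OF add.commute distrib_left[symmetric]])
  qed
  moreover have "?f 0 = 1" unfolding f by simp
  ultimately have "(\<lambda>N. ?f 0 + (\<Sum>j<N. ?f (int (Suc j)) + ?f (- int (Suc j)))) \<longlonglongrightarrow> qpoch_inf ?q ?q"
    using pentagonal_limit[OF q] by (simp only:)
  from LIMSEQ_unique[OF this lim] show ?thesis .
qed

section \<open>Leading terms of the dual series with explicit relative errors\<close>

text \<open>For T >= 1 the factor exp(-pi T) is below 1/2, so exponents that grow by at least 1 per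
  term give a geometric majorant whose ratio does not depend on \<open>T\<close>.\<close>

lemma exp_tail_le:
  assumes T: "1 \<le> T" and e: "c + real j \<le> e"
  shows "exp (- pi * e * T) \<le> exp (- pi * c * T) * (1 / 2) ^ j"
proof -
  have "exp (- pi * T) \<le> exp (- 1)"
    using T pi_gt3 mult_mono[of 1 pi 1 T] by simp
  also have "\<dots> \<le> (1 / 2 :: real)"
    using exp_ge_add_one_self[of 1] by (simp add: exp_minus field_simps)
  finally have "exp (- pi * T) ^ j \<le> (1 / 2) ^ j" by (intro power_mono) auto
  moreover have "exp (- pi * e * T) \<le> exp (- pi * c * T) * exp (- pi * T) ^ j"
  proof -
    have "pi * T * (c + real j) \<le> pi * T * e" using T e by (intro mult_left_mono) auto
    then show ?thesis
      unfolding exp_of_nat_mult[symmetric] exp_add[symmetric] by (simp add: algebra_simps)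
  qed
  ultimately show ?thesis by (meson exp_ge_zero mult_left_mono order_trans)
qed

lemma abs_suminf_le_geometric:
  fixes b :: "nat \<Rightarrow> real"
  assumes "\<And>j. \<bar>b j\<bar> \<le> B * (1 / 2) ^ j"
  shows "summable b" "\<bar>suminf b\<bar> \<le> 2 * B"
proof -
  have S: "(\<lambda>j. B * (1 / 2) ^ j) sums (B * 2)"
    using geometric_sums[of "1 / 2 :: real"] by (intro sums_mult) simp
  show "summable b"
    by (rule summable_comparison_test[OF _ sums_summable[OF S]]) (use assms in auto)
  have "norm (suminf b) \<le> (\<Sum>j. B * (1 / 2) ^ j)"
    by (rule norm_suminf_le[OF _ sums_summable[OF S]]) (use assms in auto)
  then show "\<bar>suminf b\<bar> \<le> 2 * B" using sums_unique[OF S] by simp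
qed

lemma exp_cos_tail_le:
  assumes "1 \<le> T" and "c + real j \<le> e"
  shows "\<bar>exp (- pi * e * T) * cos y\<bar> \<le> exp (- pi * c * T) * (1 / 2) ^ j"
proof -
  have "\<bar>exp (- pi * e * T) * cos y\<bar> \<le> exp (- pi * e * T) * 1"
    unfolding abs_mult by (intro mult_mono) auto
  then show ?thesis using exp_tail_le[OF assms] by simp
qed

text \<open>The constant 4 is the factor 2 of the cosine series times the geometric sum 2.\<close>

lemma dual_theta_asymp:
  assumes T: "1 \<le> T"
  obtains \<epsilon> where "dual_theta (1 / T) x = sqrt T * (1 + \<epsilon>)" "\<bar>\<epsilon>\<bar> \<le> 4 * exp (- pi * T)"
proof
  define b where "b j = exp (- pi * (real (Suc j))\<^sup>2 / (1 / T)) * cos (2 * pi * real (Suc j) * x)" for j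
  show "dual_theta (1 / T) x = sqrt T * (1 + 2 * suminf b)"
    unfolding dual_theta_def b_def[symmetric] using T by (simp add: real_sqrt_divide)
  have "\<bar>b j\<bar> \<le> exp (- pi * 1 * T) * (1 / 2) ^ j" for j
  proof -
    have "1 + real j \<le> (real (Suc j))\<^sup>2" by (simp add: power2_eq_square algebra_simps)
    from exp_cos_tail_le[OF T this] show ?thesis unfolding b_def by simp
  qed
  from abs_suminf_le_geometric(2)[of b, OF this]
  show "\<bar>2 * suminf b\<bar> \<le> 4 * exp (- pi * T)" by simp
qed

text \<open>The exponents (2j+1)^2/4 begin with 1/4 and 9/4; their gap 2 is the rate of the relative
  error. The cosine stays additive because it may vanish.\<close>

lemma odd_theta_asymp:
  assumes T: "1 \<le> T"
  obtains \<epsilon> where "odd_theta (1 / T) x = 2 * sqrt T * exp (- pi * T / 4) * (cos (pi * x) + \<epsilon>)"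
    "\<bar>\<epsilon>\<bar> \<le> 2 * exp (- 2 * pi * T)"
proof
  define b where "b j = exp (- pi * (2 * real j + 1)\<^sup>2 / (4 * (1 / T))) * cos (pi * (2 * real j + 1) * x)" for j
  have Tpos: "1 / T > 0" using T by simp
  have sb: "summable b"
    unfolding b_def by (rule dual_theta_diff_eq_odd_theta(2)[OF Tpos])
  have tail: "\<bar>b (Suc j)\<bar> \<le> exp (- pi * (9 / 4) * T) * (1 / 2) ^ j" for j
  proof -
    have "9 / 4 + real j \<le> (2 * real (Suc j) + 1)\<^sup>2 / 4" by (simp add: power2_eq_square algebra_simps)
    from exp_cos_tail_le[OF T this] show ?thesis unfolding b_def by simp
  qed
  have b0: "b 0 = exp (- pi * T / 4) * cos (pi * x)" unfolding b_def by simp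
  let ?\<epsilon> = "exp (pi * T / 4) * (\<Sum>j. b (Suc j))"
  have "odd_theta (1 / T) x = 2 * sqrt T * suminf b"
    unfolding odd_theta_def b_def[symmetric] using T by (simp add: real_sqrt_divide)
  also have "suminf b = exp (- pi * T / 4) * cos (pi * x) + (\<Sum>j. b (Suc j))"
    using suminf_split_head[OF sb] b0 by simp
  also have "\<dots> = exp (- pi * T / 4) * (cos (pi * x) + ?\<epsilon>)"
    by (simp add: distrib_left mult.assoc[symmetric] exp_add[symmetric])
  finally show "odd_theta (1 / T) x = 2 * sqrt T * exp (- pi * T / 4) * (cos (pi * x) + ?\<epsilon>)" by simp
  have "\<bar>?\<epsilon>\<bar> \<le> exp (pi * T / 4) * (2 * exp (- pi * (9 / 4) * T))"
    unfolding abs_mult using abs_suminf_le_geometric(2)[of "\<lambda>j. b (Suc j)", OF tail] by simp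
  also have "\<dots> = 2 * (exp (pi * T / 4) * exp (- pi * (9 / 4) * T))" by simp
  also have "\<dots> = 2 * exp (- 2 * pi * T)"
    unfolding exp_add[symmetric] by (simp add: algebra_simps)
  finally show "\<bar>?\<epsilon>\<bar> \<le> 2 * exp (- 2 * pi * T)" .
qed

text \<open>The second term of the series vanishes because its cosine is \<open>cos (\<pi> / 2)\<close>; this is what
  makes the relative error as small as \<open>exp (- 4 * pi * T)\<close>.\<close>

lemma qpoch_inf_asymp:
  assumes T: "1 \<le> T"
  obtains \<delta> where
    "qpoch_inf (exp (- pi * (1 / T))) (exp (- pi * (1 / T))) = sqrt (2 * T) * exp (pi / (24 * T) - pi * T / 6) * (1 + \<delta>)"
    "\<bar>\<delta>\<bar> \<le> 4 * exp (- 4 * pi * T)"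
proof
  let ?t = "3 * (1 / T) / 2"
  define b where "b j = exp (- pi * (2 * real j + 1)\<^sup>2 / (4 * ?t)) * cos (pi * (2 * real j + 1) * (1 / 6))" for j
  have Tpos: "1 / T > 0" "?t > 0" using T by auto
  have sb: "summable b"
    unfolding b_def by (rule dual_theta_diff_eq_odd_theta(2)[OF Tpos(2)])
  have expo: "- pi * (2 * real j + 1)\<^sup>2 / (4 * ?t) = - pi * ((2 * real j + 1)\<^sup>2 / 6) * T" for j
    using T by (simp add: field_simps)
  \<comment> \<open>The exponents (2j+1)^2/6 are 1/6, 9/6, 25/6 and so on. With the second term
    zero, the gap to the first is 25/6 - 1/6 = 4.\<close>
  have tail: "\<bar>b (Suc (Suc j))\<bar> \<le> exp (- pi * (25 / 6) * T) * (1 / 2) ^ j" for j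
  proof -
    have "25 / 6 + real j \<le> (2 * real (Suc (Suc j)) + 1)\<^sup>2 / 6" by (simp add: power2_eq_square algebra_simps)
    from exp_cos_tail_le[OF T this] show ?thesis unfolding b_def expo .
  qed
  have b0: "b 0 = exp (- pi * T / 6) * (sqrt 3 / 2)"
    unfolding b_def expo by (simp add: cos_30)
  have b1: "b (Suc 0) = 0"
    unfolding b_def by (simp add: mult.commute)
  let ?R = "\<Sum>j. b (Suc (Suc j))"
  \<comment> \<open>Division by the leading coefficient cos(pi/6) = sqrt 3 / 2 makes the error
    relative.\<close>
  let ?\<delta> = "2 / sqrt 3 * (exp (pi * T / 6) * ?R)"
  have sqrt: "2 * (sqrt 3 / 2) / sqrt ?t = sqrt (2 * T)"
    using T by (simp add: real_sqrt_divide real_sqrt_mult field_simps)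
  have "odd_theta ?t (1 / 6) = 2 * suminf b / sqrt ?t"
    unfolding odd_theta_def b_def[symmetric] ..
  also have "suminf b = exp (- pi * T / 6) * (sqrt 3 / 2) + ?R"
    using suminf_split_head[OF sb] suminf_split_head[of "\<lambda>j. b (Suc j)"] sb b0 b1
    by (simp add: summable_Suc_iff)
  also have "?R = exp (- pi * T / 6) * (sqrt 3 / 2) * ?\<delta>"
  proof -
    have "exp (- pi * T / 6) * (sqrt 3 / 2) * ?\<delta> = (exp (- pi * T / 6) * exp (pi * T / 6)) * ?R" by simp
    also have "\<dots> = ?R" unfolding exp_add[symmetric] by simp
    finally show ?thesis ..
  qed
  finally have "odd_theta ?t (1 / 6) = 2 * (exp (- pi * T / 6) * (sqrt 3 / 2)
     + exp (- pi * T / 6) * (sqrt 3 / 2) * ?\<delta>) / sqrt ?t" .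
  moreover have "2 * (a * s + a * s * d) / r = 2 * s / r * a * (1 + d)" for a s d r :: real
    by (simp add: algebra_simps add_divide_distrib)
  ultimately have "odd_theta ?t (1 / 6) = 2 * (sqrt 3 / 2) / sqrt ?t * exp (- pi * T / 6) * (1 + ?\<delta>)"
    by (simp only:)
  then have "odd_theta ?t (1 / 6) = sqrt (2 * T) * exp (- pi * T / 6) * (1 + ?\<delta>)"
    unfolding sqrt .
  then have "qpoch_inf (exp (- pi * (1 / T))) (exp (- pi * (1 / T)))
     = sqrt (2 * T) * (exp (pi * (1 / T) / 24) * exp (- pi * T / 6)) * (1 + ?\<delta>)"
    unfolding qpoch_inf_eq_odd_theta[OF Tpos(1)] by (simp only: mult_ac)
  moreover have "exp (pi * (1 / T) / 24) * exp (- pi * T / 6) = exp (pi / (24 * T) - pi * T / 6)"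
    unfolding exp_add[symmetric] by (simp add: mult.commute)
  ultimately show "qpoch_inf (exp (- pi * (1 / T))) (exp (- pi * (1 / T)))
     = sqrt (2 * T) * exp (pi / (24 * T) - pi * T / 6) * (1 + ?\<delta>)" by simp
  have "\<bar>?R\<bar> \<le> 2 * exp (- pi * (25 / 6) * T)"
    by (rule abs_suminf_le_geometric(2)[of "\<lambda>j. b (Suc (Suc j))", OF tail])
  then have "\<bar>?\<delta>\<bar> \<le> 2 / sqrt 3 * (exp (pi * T / 6) * (2 * exp (- pi * (25 / 6) * T)))"
    unfolding abs_mult by (intro mult_mono) auto
  also have "\<dots> \<le> 2 * (exp (pi * T / 6) * (2 * exp (- pi * (25 / 6) * T)))"
  proof (rule mult_right_mono)
    have "1 \<le> sqrt (3::real)" by simp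
    then show "2 / sqrt 3 \<le> (2::real)" by (simp add: field_simps)
  qed simp
  also have "\<dots> = 4 * (exp (pi * T / 6) * exp (- pi * (25 / 6) * T))" by simp
  also have "\<dots> = 4 * exp (- 4 * pi * T)"
    unfolding exp_add[symmetric] by (simp add: algebra_simps)
  finally show "\<bar>?\<delta>\<bar> \<le> 4 * exp (- 4 * pi * T)" .
qed

section \<open>The q-Bessel series as a perturbed theta series\<close>

text \<open>Writing q = exp(-pi t) and r = exp(-2 pi t x) and completing the square reduces the
  series to a periodized Gaussian.\<close>

lemma theta_summable:
  fixes q r :: real
  assumes q: "0 < q" "q < 1" and r: "0 < r"
  shows "(\<lambda>j::int. q powi (j ^ 2) * r powi j) summable_on UNIV"
proof -
  define t where "t = - ln q / pi"
  define x where "x = - ln r / (2 * pi * t)"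
  have t: "t > 0" using q by (simp add: t_def divide_neg_pos)
  have pt: "pi * t = - ln q" by (simp add: t_def)
  have px: "2 * (pi * t) * x = - ln r" using t by (simp add: x_def)
  have "(\<lambda>j::int. exp (pi * t * x\<^sup>2) * exp (- pi * t * (x + of_int j)\<^sup>2)) summable_on UNIV"
    by (intro summable_on_cmult_right gaussian_periodization_summable t)
  moreover have "exp (pi * t * x\<^sup>2) * exp (- pi * t * (x + of_int j)\<^sup>2) = q powi (j ^ 2) * r powi j" for j
  proof -
    have "pi * t * x\<^sup>2 + - pi * t * (x + of_int j)\<^sup>2 = - (pi * t) * (of_int j)\<^sup>2 - (2 * (pi * t) * x) * of_int j"
      by (simp add: power2_eq_square algebra_simps)
    also have "\<dots> = of_int (j ^ 2) * ln q + of_int j * ln r"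
      unfolding px unfolding pt by simp
    finally have "exp (pi * t * x\<^sup>2) * exp (- pi * t * (x + of_int j)\<^sup>2)
       = exp (of_int (j ^ 2) * ln q) * exp (of_int j * ln r)"
      by (simp only: exp_add[symmetric])
    then show ?thesis unfolding exp_power_int[symmetric] using q r by simp
  qed
  ultimately show ?thesis by simp
qed

text \<open>For j = N + l the cross term 2Nl in j^2 is dropped. A theta tail is thereby bounded by a
  small factor times a shifted theta series.\<close>

lemma powi_shifted_le:
  fixes q r :: real
  assumes q: "0 < q" "q < 1" and r: "0 < r" and j: "int N < j"
  shows "q powi (j ^ 2) * r powi j \<le> q ^ N\<^sup>2 * r ^ N * (q powi ((j - int N) ^ 2) * r powi (j - int N))"
proof -
  define l where "l = nat (j - int N)"
  have l: "j = int N + int l" using j by (simp add: l_def)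
  have "q powi (j ^ 2) * r powi j = q ^ (N + l)\<^sup>2 * r ^ (N + l)"
    unfolding l of_nat_add[symmetric] of_nat_power[symmetric] power_int_of_nat ..
  also have "\<dots> \<le> q ^ (N\<^sup>2 + l\<^sup>2) * r ^ (N + l)"
    using q r by (intro mult_right_mono power_decreasing) (auto simp: power2_eq_square algebra_simps)
  also have "\<dots> = q ^ N\<^sup>2 * r ^ N * (q ^ l\<^sup>2 * r ^ l)"
    by (simp add: power_add)
  also have "q ^ l\<^sup>2 * r ^ l = q powi ((j - int N) ^ 2) * r powi (j - int N)"
    unfolding l add_diff_cancel_left' of_nat_power[symmetric] power_int_of_nat ..
  finally show ?thesis .
qed

text \<open>The coefficient left of the k-th Bessel summand once 1/(q;q)^2, with the infinite
  product, is extracted. It is the product of the infinite Pochhammer symbols of q^(nu+1+k) and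
  q^(k+1), so it tends to 1.\<close>

definition qtail :: "real \<Rightarrow> real \<Rightarrow> nat \<Rightarrow> real" where
  "qtail q \<nu> k = qpoch_inf (q powr (\<nu> + 1)) q / qpoch (q powr (\<nu> + 1)) q k * (qpoch_inf q q / qpoch q q k)"

lemma powr_lt_one:
  fixes q a :: real
  assumes "0 < q" "q < 1" "0 < a"
  shows "q powr a < 1"
  using assms by (simp add: powr_def mult_pos_neg)

lemma qtail_bounds:
  assumes q: "0 < q" "q < 1" and \<nu>: "-1 < \<nu>"
  shows "0 \<le> qtail q \<nu> k" "qtail q \<nu> k \<le> 1" "1 - qtail q \<nu> k \<le> 2 * q ^ k / (1 - q)"
proof -
  let ?c = "q powr (\<nu> + 1)"
  define x where "x = qpoch_inf ?c q / qpoch ?c q k"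
  define y where "y = qpoch_inf q q / qpoch q q k"
  have c: "0 < ?c" "?c < 1" using q \<nu> by (auto intro: powr_lt_one)
  have x: "0 \<le> x" "x \<le> 1" "1 - ?c * q ^ k / (1 - q) \<le> x"
    using qpoch_tail[OF q c, of k] qpoch_inf_pos[OF q c] qpoch_pos[OF q c, of k] by (auto simp: x_def)
  have y: "0 \<le> y" "y \<le> 1" "1 - q * q ^ k / (1 - q) \<le> y"
    using qpoch_tail[OF q q, of k] qpoch_inf_pos[OF q q] qpoch_pos[OF q q, of k] by (auto simp: y_def)
  have P: "qtail q \<nu> k = x * y" by (simp add: qtail_def x_def y_def)
  show "0 \<le> qtail q \<nu> k" "qtail q \<nu> k \<le> 1"
    unfolding P using x y by (auto intro: mult_le_one)
  have le: "d * q ^ k / (1 - q) \<le> q ^ k / (1 - q)" if "d < 1" for d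
    using q that by (intro divide_right_mono) (auto intro: mult_left_le_one_le simp: mult_le_cancel_right1)
  \<comment> \<open>The defect of a product is at most the sum of the defects; each is at most
    q^k/(1-q), whence the factor 2.\<close>
  have "x * (1 - y) \<le> 1 * (1 - y)" using x y by (intro mult_right_mono) auto
  then have "1 - x * y \<le> (1 - x) + (1 - y)" by (simp add: algebra_simps)
  also have "\<dots> \<le> q ^ k / (1 - q) + q ^ k / (1 - q)"
    using x(3) y(3) le[OF c(2)] le[OF q(2)] by linarith
  finally show "1 - qtail q \<nu> k \<le> 2 * q ^ k / (1 - q)" unfolding P by simp
qed

context
  fixes q \<nu> :: real and z :: complex and n :: nat
  assumes q: "0 < q" "q < 1" and z: "z \<noteq> 0" and \<nu>: "-1 < \<nu>"
begin

definition theta4_term :: "int \<Rightarrow> complex" where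
  "theta4_term j = (-1) powi j * of_real (q powi (j ^ 2)) * inverse z powi j"

text \<open>The power of the argument contributes -(n + nu/2)(nu + 2k) to the exponent of
  \<open>q\<close>, and the series contributes k(nu + k). The sum is (n-k)^2 - (n^2 + n nu +
  nu^2/2): a theta exponent minus a term free of \<open>k\<close>.\<close>

lemma jackson_summand:
  "of_real (qpoch_inf (q powr (\<nu> + 1)) q / qpoch_inf q q) *
    ((-1) ^ k * csqrt (z * of_real (q powr (- 2 * real n - \<nu>))) powr of_real (\<nu> + 2 * real k)
      / of_real (qpoch q q k * qpoch (q powr (\<nu> + 1)) q k) * of_real (q powr (real k * (\<nu> + real k))))
   = z powr of_real (real n + \<nu> / 2) / ((-1) ^ n * of_real ((qpoch_inf q q)\<^sup>2 *
                q powr ((real n)\<^sup>2 + real n * \<nu> + \<nu>\<^sup>2 / 2)))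
      * (theta4_term (int n - int k) * of_real (qtail q \<nu> k))" (is "?L = ?R")
proof -
  define l where "l = ln q"
  define Z where "Z = Ln z"
  define w where "w = q powr (- 2 * real n - \<nu>)"
  define y where "y = \<nu> / 2 + real k"
  have qp: "q powr a = exp (a * l)" for a using q by (simp add: powr_def l_def)
  have w: "w > 0" using q by (simp add: w_def)
  have lnw: "ln w = (- 2 * real n - \<nu>) * l" by (simp add: w_def l_def ln_powr)
  have eZ: "exp Z = z" using z by (simp add: Z_def)
  have Y: "csqrt (z * of_real w) powr of_real (\<nu> + 2 * real k)
     = exp (of_real y * Z) * of_real (exp (y * ln w))"
  proof -
    have nz: "z * of_real w \<noteq> 0" using z w by simp
    have L: "Ln (z * of_real w) = Z + of_real (ln w)"
      using Ln_times_of_real[OF w z] Ln_of_real[OF w] by (simp add: Z_def mult.commute)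
    \<comment> \<open>Half of a principal logarithm has imaginary part in (-pi/2, pi/2], so it is
      the principal logarithm of the root and no branch correction occurs.\<close>
    have LnE: "Ln (exp (Ln (z * of_real w) / 2)) = Ln (z * of_real w) / 2"
      by (rule Ln_exp) (use mpi_less_Im_Ln[OF nz] Im_Ln_le_pi[OF nz] pi_gt_zero in simp_all)
    have "csqrt (z * of_real w) powr of_real (\<nu> + 2 * real k)
       = exp (of_real (\<nu> + 2 * real k) * (Ln (z * of_real w) / 2))"
      unfolding csqrt_exp_Ln[OF nz] powr_def LnE by simp
    also have "of_real (\<nu> + 2 * real k) * (Ln (z * of_real w) / 2) = of_real y * Z + of_real (y * ln w)"
      unfolding L y_def by (simp add: field_simps)
    finally show ?thesis by (simp only: exp_add exp_of_real)
  qed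
  have zn: "z powr of_real (real n + \<nu> / 2) = exp (of_real (real n + \<nu> / 2) * Z)"
    using z by (simp add: powr_def Z_def)
  have th: "theta4_term (int n - int k) = (-1) ^ n * (-1) ^ k * of_real (exp ((real n - real k)\<^sup>2 * l)) * exp ((of_nat k - of_nat n) * Z)"
  proof -
    have 1: "(-1::complex) powi (int n - int k) = (-1) ^ n * (-1) ^ k"
      by (simp add: power_int_diff) (auto simp: minus_one_power_iff)
    have 2: "q powi ((int n - int k) ^ 2) = exp ((real n - real k)\<^sup>2 * l)"
    proof -
      have "q = exp l" using q by (simp add: l_def)
      then show ?thesis by (simp add: exp_power_int)
    qed
    have 3: "inverse z powi (int n - int k) = exp ((of_nat k - of_nat n) * Z)"
    proof -
      have "inverse z = exp (- Z)" by (simp add: exp_minus eZ)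
      then show ?thesis by (simp add: exp_power_int algebra_simps)
    qed
    show ?thesis unfolding theta4_term_def 1 2 3 ..
  qed
  have P: "qpoch q q m > 0" "qpoch (q powr (\<nu> + 1)) q m > 0" "qpoch_inf q q > 0" for m
    using q \<nu> by (auto intro!: qpoch_pos qpoch_inf_pos powr_lt_one)
  have expz: "exp (of_real y * Z) = exp (of_real (real n + \<nu> / 2) * Z) * exp ((of_nat k - of_nat n) * Z)"
    unfolding exp_add[symmetric] by (simp add: y_def algebra_simps)
  have expr: "exp (y * ln w) * exp (real k * (\<nu> + real k) * l) * exp (((real n)\<^sup>2 + real n * \<nu> + \<nu>\<^sup>2 / 2) * l)
     = exp ((real n - real k)\<^sup>2 * l)"
    unfolding exp_add[symmetric] lnw y_def by (simp add: power2_eq_square field_simps)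
  define a b c d p where "a = qpoch_inf (q powr (\<nu> + 1)) q" and "b = qpoch_inf q q"
    and "c = qpoch q q k" and "d = qpoch (q powr (\<nu> + 1)) q k"
    and "p = exp (((real n)\<^sup>2 + real n * \<nu> + \<nu>\<^sup>2 / 2) * l)"
  have nz: "b \<noteq> 0" "c \<noteq> 0" "d \<noteq> 0" "p \<noteq> 0"
    using P(1)[of k] P(2)[of k] P(3) by (auto simp: b_def c_def d_def p_def)
  have real_id: "a / b * (exp (y * ln w) * exp (real k * (\<nu> + real k) * l)) / (c * d)
     = exp ((real n - real k)\<^sup>2 * l) * (a / d * (b / c)) / (b\<^sup>2 * p)"
    unfolding expr[folded p_def, symmetric] using nz by (simp add: field_simps power2_eq_square)
  have "?L = (-1) ^ k * exp (of_real y * Z) *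
      of_real (a / b * (exp (y * ln w) * exp (real k * (\<nu> + real k) * l)) / (c * d))"
    unfolding w_def[symmetric] Y qp[of "real k * (\<nu> + real k)"] a_def b_def c_def d_def
    by (simp add: field_simps)
  \<comment> \<open>A factor 1 = (-1)^n (-1)^n is inserted: one sign belongs to the prefactor, the
    other joins (-1)^k in the theta term.\<close>
  also have "\<dots> = (-1) ^ n * (-1) ^ n * (-1) ^ k * exp (of_real y * Z) *
      of_real (exp ((real n - real k)\<^sup>2 * l) * (a / d * (b / c)) / (b\<^sup>2 * p))"
    unfolding real_id by (simp flip: power_mult_distrib)
  also have "\<dots> = ?R"
    unfolding zn th qtail_def expz qp[of "(real n)\<^sup>2 + real n * \<nu> + \<nu>\<^sup>2 / 2"]
      a_def[symmetric] b_def[symmetric] c_def[symmetric] d_def[symmetric] p_def[symmetric]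
    using nz by (simp add: field_simps)
  finally show ?thesis .
qed

lemma norm_theta4_term: "norm (theta4_term j) = q powi (j ^ 2) * inverse (norm z) powi j"
  unfolding theta4_term_def using q by (simp add: norm_mult norm_power_int norm_inverse)

lemma norm_theta4_term_has_sum:
  "((\<lambda>j. norm (theta4_term j)) has_sum theta3 (inverse (norm z)) q) UNIV"
proof -
  have "(\<lambda>j. q powi (j ^ 2) * inverse (norm z) powi j) summable_on UNIV"
    using z by (intro theta_summable q) simp
  then show ?thesis unfolding norm_theta4_term theta3_def of_real_eq_id id_apply by (rule has_sum_infsum)
qed

lemma theta4_term_has_sum: "(theta4_term has_sum theta4 (inverse z) q) UNIV"
  using has_sum_infsum[OF abs_summable_summable[of theta4_term UNIV]] norm_theta4_term_has_sum
  unfolding theta4_def theta4_term_def[abs_def] summable_on_def by blast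

text \<open>The summation index of \<open>theta4_term\<close> is \<open>j = n - k\<close>, where \<open>k\<close> is that of the
  \<open>q\<close>-Bessel series; hence the cut-off at \<open>n\<close>.\<close>

definition weight :: "int \<Rightarrow> real" where
  "weight j = (if j \<le> int n then qtail q \<nu> (nat (int n - j)) else 0)"

lemma weight_bounds: "0 \<le> weight j" "weight j \<le> 1"
  unfolding weight_def using qtail_bounds[OF q \<nu>] by auto

text \<open>The error is the theta series with coefficients weight minus 1. The estimate holds for
  every \<open>n\<close> with constants free of \<open>q\<close>, as needed when \<open>q\<close>
  varies with \<open>n\<close>.\<close>

lemma jackson_theta4_error:
  obtains e where
    "jackson_J2 \<nu> (2 * csqrt (z * of_real (q powr (- 2 * real n - \<nu>)))) q =
       z powr of_real (real n + \<nu> / 2) * (theta4 (inverse z) q + e) /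
         ((-1) ^ n * of_real ((qpoch_inf q q)\<^sup>2 * q powr ((real n)\<^sup>2 + real n * \<nu> + \<nu>\<^sup>2 / 2)))"
    "norm e \<le> 2 * theta3 (inverse (norm z)) q *
       (q powr (real n / 2) / (1 - q) + q ^ ((n div 2)\<^sup>2) / norm z ^ (n div 2))"
proof -
  let ?s = "\<lambda>j. theta4_term j * of_real (weight j)"
  let ?\<Theta> = "theta3 (inverse (norm z)) q :: real"
  \<comment> \<open>The split at n/2 serves both ranges. For j <= N the Bessel index n - j is at
    least n/2, so the weight is within \<open>A\<close> of 1; for j > N the defect is at most 1 and
    the theta term itself is small.\<close>
  define N where "N = n div 2"
  define A where "A = 2 * q powr (real n / 2) / (1 - q)"
  define B where "B = q ^ N\<^sup>2 * inverse (norm z) ^ N"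
  have A0: "A \<ge> 0" and B0: "B \<ge> 0" using q by (auto simp: A_def B_def)
  have "(\<lambda>j. norm (?s j)) summable_on UNIV"
  proof (rule Infinite_Sum.abs_summable_on_comparison_test')
    show "(\<lambda>j. norm (theta4_term j)) summable_on UNIV"
      using norm_theta4_term_has_sum by (auto simp: summable_on_def)
    show "norm (?s j) \<le> norm (theta4_term j)" for j
      using weight_bounds[of j] by (simp add: norm_mult mult_left_le)
  qed
  then have "?s summable_on UNIV" by (rule abs_summable_summable)
  then obtain W where W: "(?s has_sum W) UNIV"
    unfolding summable_on_def by blast
  have "(?s has_sum W) {..int n}"
    by (rule has_sum_cong_neutral[THEN iffD1, rotated -1, OF W]) (auto simp: weight_def)
  then have "((\<lambda>k. ?s (int n - int k)) has_sum W) (UNIV :: nat set)"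
    by (subst has_sum_reindex_bij_witness[where j = "\<lambda>k. int n - int k" and i = "\<lambda>j. nat (int n - j)"
          and T = "{..int n}" and h = ?s and s' = W]) auto
  moreover have "?s (int n - int k) = theta4_term (int n - int k) * of_real (qtail q \<nu> k)" for k
    by (simp add: weight_def)
  ultimately have "(\<lambda>k. theta4_term (int n - int k) * of_real (qtail q \<nu> k)) sums W"
    by (intro has_sum_imp_sums) simp
  define D where "D = z powr of_real (real n + \<nu> / 2) / ((-1) ^ n * of_real ((qpoch_inf q q)\<^sup>2 *
                q powr ((real n)\<^sup>2 + real n * \<nu> + \<nu>\<^sup>2 / 2)))"
  let ?C = "complex_of_real (qpoch_inf (q powr (\<nu> + 1)) q / qpoch_inf q q)"
  have C: "?C \<noteq> 0"
    using qpoch_inf_pos[OF q q] qpoch_inf_pos[OF q, of "q powr (\<nu> + 1)"] q \<nu> by (auto simp: powr_lt_one)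
  have "(\<lambda>k. D * (theta4_term (int n - int k) * of_real (qtail q \<nu> k))) sums (D * W)"
    by (rule sums_mult) fact
  from this[folded jackson_summand[folded D_def]]
  have "(\<lambda>k. (-1) ^ k * csqrt (z * of_real (q powr (- 2 * real n - \<nu>))) powr of_real (\<nu> + 2 * real k)
      / of_real (qpoch q q k * qpoch (q powr (\<nu> + 1)) q k) * of_real (q powr (real k * (\<nu> + real k)))) sums (D * W / ?C)"
    by (rule sums_mult_D[OF _ C])
  then have J: "jackson_J2 \<nu> (2 * csqrt (z * of_real (q powr (- 2 * real n - \<nu>)))) q = D * W"
    unfolding jackson_J2_def using C by (simp add: sums_iff)
  have "((\<lambda>j. ?s j + (-1) * theta4_term j) has_sum (W + (-1) * theta4 (inverse z) q)) UNIV"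
    by (intro has_sum_add has_sum_cmult_right W theta4_term_has_sum)
  \<comment> \<open>Each majorant is summed over all integers, where a shift by \<open>N\<close>
    does not change the total, so both give multiples of \<open>theta3\<close>.\<close>
  moreover have "((\<lambda>j. A * norm (theta4_term j) + B * norm (theta4_term (j - int N))) has_sum (A * ?\<Theta> + B * ?\<Theta>)) UNIV"
  proof (intro has_sum_add has_sum_cmult_right norm_theta4_term_has_sum)
    show "((\<lambda>j. norm (theta4_term (j - int N))) has_sum ?\<Theta>) UNIV"
      by (subst has_sum_reindex_bij_witness[where j = "\<lambda>j. j - int N" and i = "\<lambda>j. j + int N"
          and T = UNIV and h = "\<lambda>j. norm (theta4_term j)" and s' = ?\<Theta>])
         (use norm_theta4_term_has_sum in auto)
  qed
  moreover have "norm (?s j + (-1) * theta4_term j) \<le> A * norm (theta4_term j) + B * norm (theta4_term (j - int N))" for j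
  proof -
    have "?s j + (-1) * theta4_term j = theta4_term j * of_real (weight j - 1)"
      by (simp add: algebra_simps)
    then have eq: "norm (?s j + (-1) * theta4_term j) = norm (theta4_term j) * (1 - weight j)"
      using weight_bounds[of j] by (simp add: norm_mult del: of_real_diff)
    show ?thesis
    proof (cases "j \<le> int N")
      case True
      define k where "k = nat (int n - j)"
      have k: "real n / 2 \<le> real k" using True unfolding k_def N_def by linarith
      have "1 - weight j \<le> 2 * q ^ k / (1 - q)"
        using True qtail_bounds(3)[OF q \<nu>, of k] unfolding weight_def k_def N_def by auto
      also have "q ^ k \<le> q powr (real n / 2)"
        using q k by (simp add: powr_mono' flip: powr_realpow)
      then have "2 * q ^ k / (1 - q) \<le> A"
        unfolding A_def using q by (intro divide_right_mono) auto
      finally have "norm (theta4_term j) * (1 - weight j) \<le> norm (theta4_term j) * A"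
        by (intro mult_left_mono) auto
      moreover have "0 \<le> B * norm (theta4_term (j - int N))" using B0 by simp
      ultimately show ?thesis unfolding eq by (simp add: mult.commute)
    next
      case False
      then have "norm (theta4_term j) \<le> B * norm (theta4_term (j - int N))"
        unfolding norm_theta4_term B_def using z by (intro powi_shifted_le q) auto
      moreover have "norm (theta4_term j) * (1 - weight j) \<le> norm (theta4_term j) * 1"
        using weight_bounds[of j] by (intro mult_left_mono) auto
      moreover have "0 \<le> A * norm (theta4_term j)" using A0 by simp
      ultimately show ?thesis unfolding eq by linarith
    qed
  qed
  ultimately have "norm (W + (-1) * theta4 (inverse z) q) \<le> A * ?\<Theta> + B * ?\<Theta>"
    by (rule norm_infsum_le)
  moreover have "A * ?\<Theta> + B * ?\<Theta> \<le> 2 * ?\<Theta> * (q powr (real n / 2) / (1 - q) + q ^ (N\<^sup>2) / norm z ^ N)"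
  proof -
    have "0 \<le> ?\<Theta>" by (rule has_sum_nonneg[OF norm_theta4_term_has_sum]) simp
    \<comment> \<open>\<open>A\<close> contains a factor 2 and \<open>B\<close> does not;
      nonnegativity lets both be bounded with the common factor 2.\<close>
    then have "0 \<le> B * ?\<Theta>" using B0 by simp
    moreover have "B = q ^ (N\<^sup>2) / norm z ^ N" by (simp add: B_def power_inverse divide_inverse)
    ultimately show ?thesis unfolding A_def by (simp add: algebra_simps)
  qed
  ultimately have "norm (W - theta4 (inverse z) q) \<le>
      2 * ?\<Theta> * (q powr (real n / 2) / (1 - q) + q ^ (N\<^sup>2) / norm z ^ N)" by simp
  moreover have "D * W = z powr of_real (real n + \<nu> / 2) * (theta4 (inverse z) q + (W - theta4 (inverse z) q)) /
         ((-1) ^ n * of_real ((qpoch_inf q q)\<^sup>2 * q powr ((real n)\<^sup>2 + real n * \<nu> + \<nu>\<^sup>2 / 2)))"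
    unfolding D_def by simp
  ultimately show ?thesis using that J unfolding N_def by metis
qed

end

section \<open>Asymptotics along q tending to 1\<close>

definition cutoff_error :: "real \<Rightarrow> real \<Rightarrow> nat \<Rightarrow> real" where
  "cutoff_error q r n = q powr (real n / 2) / (1 - q) + q ^ ((n div 2)\<^sup>2) / r ^ (n div 2)"

lemma cutoff_error_nonneg:
  assumes "0 < q" "q < 1" "0 < r"
  shows "0 \<le> cutoff_error q r n"
  unfolding cutoff_error_def using assms by simp

text \<open>Combines the theta error with that of the squared Euler product. The square is at least
  1/4, so dividing costs a factor 4, and |2d + d^2| <= 3|d| then gives 12.\<close>

lemma divide_square_perturb:
  fixes c \<epsilon> :: complex and \<delta> :: real
  assumes c: "norm c \<le> 1" and \<delta>: "\<bar>\<delta>\<bar> \<le> 1 / 2"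
  shows "norm ((c + \<epsilon>) / of_real ((1 + \<delta>)\<^sup>2) - c) \<le> 4 * norm \<epsilon> + 12 * \<bar>\<delta>\<bar>"
proof -
  have lower: "1 / 4 \<le> (1 + \<delta>)\<^sup>2"
    using power_mono[of "1 / 2" "1 + \<delta>" 2] \<delta> by (simp add: power2_eq_square abs_le_iff)
  have "(c + \<epsilon>) / of_real ((1 + \<delta>)\<^sup>2) - c = (\<epsilon> - c * of_real (2 * \<delta> + \<delta>\<^sup>2)) / of_real ((1 + \<delta>)\<^sup>2)"
  proof -
    have "(1 + \<delta>)\<^sup>2 \<noteq> 0" using lower by linarith
    then have "complex_of_real ((1 + \<delta>)\<^sup>2) \<noteq> 0" unfolding of_real_eq_0_iff .
    moreover have "complex_of_real ((1 + \<delta>)\<^sup>2) = 1 + of_real (2 * \<delta> + \<delta>\<^sup>2)"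
      by (simp add: power2_eq_square algebra_simps)
    ultimately show ?thesis
      by (simp add: field_simps del: of_real_power)
  qed
  then have "norm ((c + \<epsilon>) / of_real ((1 + \<delta>)\<^sup>2) - c) = norm (\<epsilon> - c * of_real (2 * \<delta> + \<delta>\<^sup>2)) / (1 + \<delta>)\<^sup>2"
    by (simp only: norm_divide norm_of_real abs_power2)
  also have "\<dots> \<le> norm (\<epsilon> - c * of_real (2 * \<delta> + \<delta>\<^sup>2)) / (1 / 4)"
    using lower by (intro divide_left_mono) auto
  also have "\<dots> \<le> 4 * (norm \<epsilon> + 1 * (3 * \<bar>\<delta>\<bar>))"
  proof -
    have "\<bar>2 * \<delta> + \<delta>\<^sup>2\<bar> \<le> 2 * \<bar>\<delta>\<bar> + \<bar>\<delta>\<bar> * \<bar>\<delta>\<bar>"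
      using abs_triangle_ineq[of "2 * \<delta>" "\<delta>\<^sup>2"] by (simp add: abs_mult power2_eq_square)
    also have "\<bar>\<delta>\<bar> * \<bar>\<delta>\<bar> \<le> 1 * \<bar>\<delta>\<bar>" using \<delta> by (intro mult_right_mono) auto
    finally have "\<bar>2 * \<delta> + \<delta>\<^sup>2\<bar> \<le> 3 * \<bar>\<delta>\<bar>" by simp
    then have "norm (c * of_real (2 * \<delta> + \<delta>\<^sup>2)) \<le> 1 * (3 * \<bar>\<delta>\<bar>)"
      unfolding norm_mult norm_of_real by (intro mult_mono c) auto
    with norm_triangle_ineq4[of \<epsilon> "c * of_real (2 * \<delta> + \<delta>\<^sup>2)"] show ?thesis by simp
  qed
  finally show ?thesis by simp
qed

text \<open>Separates the algebra of sqrt T from the exponentials, so that a prefactor identity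
  becomes a comparison of exponents.\<close>

lemma exp_factor_regroup:
  fixes a E g h p s T x :: real
  assumes eq: "a * E * g = h * p * x" and T: "T = s * s" and nz: "s \<noteq> 0" "p \<noteq> 0" "x \<noteq> 0" "g \<noteq> 0"
  shows "a * (s * E) / (2 * T * p * x) = h / (2 * s * g)"
proof -
  have "a * (s * E) * (2 * s * g) = 2 * (s * s) * (a * E * g)" by simp
  also have "\<dots> = h * (2 * T * p * x)" unfolding eq T by simp
  finally show ?thesis using nz T by (subst frac_eq_eq) auto
qed

lemma of_real_regroup:
  fixes s Y :: complex and a M B d x :: real
  shows "of_real a * (of_real M * Y) / (s * of_real (B * d * x))
    = of_real (a * M / (B * x)) * (Y / of_real d) / s"
  by (simp add: divide_inverse inverse_mult_distrib mult_ac)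

context
  fixes T u \<nu> :: real and n :: nat
  assumes T: "1 \<le> T"
begin

abbreviation "qT \<equiv> exp (- pi * (1 / T))"

lemma qT: "0 < qT" "qT < 1" "1 / T > 0"
  using T by auto

lemma qT_powr: "qT powr x = exp (- pi * x / T)"
  by (simp add: powr_def)

text \<open>Fixes |z| = exp(2 pi u): with it, the arguments in (ii) become square roots of the form
  required by the error estimate.\<close>

lemma argument_square: "exp (2 * pi * u) * qT powr (- 2 * real n - \<nu>) = (exp (pi * (u + real n / T + \<nu> / (2 * T))))\<^sup>2"
  unfolding qT_powr exp_double[symmetric] exp_add[symmetric] using T by (simp add: field_simps)

text \<open>One error serves two purposes: the first formula evaluates \<open>theta4\<close> at
  negative arguments, the second the \<open>theta3\<close> in the error bound.\<close>

lemma theta_approximation: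
  obtains \<epsilon> where
    "exp (pi * u\<^sup>2 / (1 / T)) * dual_theta (1 / T) (u / (1 / T)) = sqrt T * exp (pi * u\<^sup>2 * T) * (1 + \<epsilon>)"
    "theta3 (inverse (exp (2 * pi * u))) qT = sqrt T * exp (pi * u\<^sup>2 * T) * (1 + \<epsilon>)"
    "\<bar>\<epsilon>\<bar> \<le> 4 * exp (- pi * T)"
proof -
  obtain \<epsilon> where \<epsilon>: "dual_theta (1 / T) (u / (1 / T)) = sqrt T * (1 + \<epsilon>)" "\<bar>\<epsilon>\<bar> \<le> 4 * exp (- pi * T)"
    using dual_theta_asymp[OF T] by blast
  have 1: "exp (pi * u\<^sup>2 / (1 / T)) * dual_theta (1 / T) (u / (1 / T)) = sqrt T * exp (pi * u\<^sup>2 * T) * (1 + \<epsilon>)"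
    unfolding \<epsilon>(1) by simp
  have "inverse (exp (2 * pi * u)) = exp (- 2 * pi * u)" by (simp add: exp_minus)
  then have "theta3 (inverse (exp (2 * pi * u))) qT = exp (pi * u\<^sup>2 / (1 / T)) * dual_theta (1 / T) (u / (1 / T))"
    using theta3_exp[OF qT(3), of u] by (simp only:)
  then show ?thesis using that[OF 1 _ \<epsilon>(2)] 1 by simp
qed

lemma theta3_le: "theta3 (inverse (exp (2 * pi * u))) qT \<le> 5 * (sqrt T * exp (pi * u\<^sup>2 * T))"
proof -
  obtain \<epsilon> where \<epsilon>: "theta3 (inverse (exp (2 * pi * u))) qT = sqrt T * exp (pi * u\<^sup>2 * T) * (1 + \<epsilon>)"
    "\<bar>\<epsilon>\<bar> \<le> 4 * exp (- pi * T)"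
    using theta_approximation by blast
  have "exp (- pi * T) \<le> 1" using T by simp
  then have "1 + \<epsilon> \<le> 5" using \<epsilon>(2) by linarith
  then have "sqrt T * exp (pi * u\<^sup>2 * T) * (1 + \<epsilon>) \<le> sqrt T * exp (pi * u\<^sup>2 * T) * 5"
    using T by (intro mult_left_mono) auto
  then show ?thesis unfolding \<epsilon>(1) by simp
qed

lemma qpoch_inf_qT:
  obtains \<delta> where
    "(qpoch_inf qT qT)\<^sup>2 = 2 * T * exp (pi / (12 * T) - pi * T / 3) * (1 + \<delta>)\<^sup>2"
    "\<bar>\<delta>\<bar> \<le> 4 * exp (- 4 * pi * T)" "\<bar>\<delta>\<bar> \<le> 1 / 2"
proof -
  obtain \<delta> where \<delta>: "qpoch_inf qT qT = sqrt (2 * T) * exp (pi / (24 * T) - pi * T / 6) * (1 + \<delta>)"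
    "\<bar>\<delta>\<bar> \<le> 4 * exp (- 4 * pi * T)"
    using qpoch_inf_asymp[OF T] by blast
  have "(exp (pi / (24 * T) - pi * T / 6))\<^sup>2 = exp (pi / (12 * T) - pi * T / 3)"
    unfolding exp_double[symmetric] by (simp add: right_diff_distrib)
  then have sq: "(qpoch_inf qT qT)\<^sup>2 = 2 * T * exp (pi / (12 * T) - pi * T / 3) * (1 + \<delta>)\<^sup>2"
    unfolding \<delta>(1) power_mult_distrib using T by simp
  have "12 * 1 \<le> 4 * pi * T" using pi_gt3 T by (intro mult_mono) auto
  then have "13 \<le> exp (4 * pi * T)" using exp_ge_add_one_self[of "4 * pi * T"] by linarith
  then have "4 * exp (- 4 * pi * T) \<le> 1 / 2" by (simp add: exp_minus field_simps)
  with \<delta> sq that show ?thesis by force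
qed

text \<open>Here z = -exp(2 pi u), whose principal root supplies the factor \<i>. In the bound 64 =
  4*4 + 12*4 collects the theta and Euler product errors, and 40 = 4*10 the cut-off error, with 10 =
  2*5 from \<open>theta3_le\<close>.\<close>

lemma jackson_imaginary_argument:
  assumes \<nu>: "-1 < \<nu>"
  obtains E where
    "jackson_J2 \<nu> (2 * \<i> * of_real (exp (pi * (u + real n / T + \<nu> / (2 * T))))) qT =
       \<i> powr of_real \<nu> * of_real (exp (pi / T * (T * u + real n + \<nu> / 2)\<^sup>2)) * (1 + E) /
       of_real (2 * sqrt T * exp (pi * (1 / (12 * T) - T / 3 - \<nu>\<^sup>2 / (4 * T))))"
    "norm E \<le> 64 * exp (- pi * T) + 40 * cutoff_error qT (exp (2 * pi * u)) n"
proof -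
  define r where "r = exp (2 * pi * u)"
  define z where "z = - complex_of_real r"
  define M where "M = sqrt T * exp (pi * u\<^sup>2 * T)"
  define X where "X = (real n)\<^sup>2 + real n * \<nu> + \<nu>\<^sup>2 / 2"
  have r: "r > 0" by (simp add: r_def)
  have M: "M > 0" using T by (simp add: M_def)
  have z: "z \<noteq> 0" "norm z = r" using r by (auto simp: z_def)
  obtain e where J: "jackson_J2 \<nu> (2 * csqrt (z * of_real (qT powr (- 2 * real n - \<nu>)))) qT =
       z powr of_real (real n + \<nu> / 2) * (theta4 (inverse z) qT + e) /
         ((-1) ^ n * of_real ((qpoch_inf qT qT)\<^sup>2 * qT powr X))"
    and e: "norm e \<le> 2 * theta3 (inverse r) qT * cutoff_error qT r n"
    using jackson_theta4_error[OF qT(1,2) z(1) \<nu>, of n] unfolding z(2) X_def cutoff_error_def by blast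
  have arg: "csqrt (z * of_real (qT powr (- 2 * real n - \<nu>))) = \<i> * of_real (exp (pi * (u + real n / T + \<nu> / (2 * T))))"
  proof -
    have "z * of_real (qT powr (- 2 * real n - \<nu>)) = - of_real ((exp (pi * (u + real n / T + \<nu> / (2 * T))))\<^sup>2)"
      unfolding argument_square[symmetric] z_def r_def by simp
    then show ?thesis by (subst csqrt_of_real_nonpos) (simp_all del: of_real_power)
  qed
  obtain \<epsilon> where \<epsilon>: "exp (pi * u\<^sup>2 / (1 / T)) * dual_theta (1 / T) (u / (1 / T)) = M * (1 + \<epsilon>)"
    "\<bar>\<epsilon>\<bar> \<le> 4 * exp (- pi * T)"
    using theta_approximation unfolding M_def by blast
  have "inverse z = - complex_of_real (exp (- 2 * pi * u))"
    by (simp add: z_def r_def exp_minus)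
  then have th: "theta4 (inverse z) qT = of_real (M * (1 + \<epsilon>))"
    using theta4_neg_exp[OF qT(3), of u] \<epsilon>(1) by (simp only:)
  obtain \<delta> where \<delta>: "(qpoch_inf qT qT)\<^sup>2 = 2 * T * exp (pi / (12 * T) - pi * T / 3) * (1 + \<delta>)\<^sup>2"
    "\<bar>\<delta>\<bar> \<le> 4 * exp (- 4 * pi * T)" "\<bar>\<delta>\<bar> \<le> 1 / 2"
    using qpoch_inf_qT by blast
  define \<eta> where "\<eta> = of_real \<epsilon> + e / of_real M"
  define E where "E = (1 + \<eta>) / of_real ((1 + \<delta>)\<^sup>2) - 1"
  \<comment> \<open>The principal logarithm of a negative number has imaginary part pi; this yields
    i^nu and a sign (-1)^n that cancels the one in the denominator.\<close>
  have zp: "z powr of_real (real n + \<nu> / 2) = (-1) ^ n * (\<i> powr of_real \<nu>) * of_real (exp (2 * pi * u * (real n + \<nu> / 2)))"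
  proof -
    have "Ln z = of_real (2 * pi * u) + \<i> * of_real pi"
      unfolding z_def r_def using Ln_minus[of "of_real (exp (2 * pi * u))"] by (simp add: Ln_of_real)
    then have "z powr of_real (real n + \<nu> / 2) = exp (of_real (real n + \<nu> / 2) * (of_real (2 * pi * u) + \<i> * of_real pi))"
      using z by (simp add: powr_def)
    also have "of_real (real n + \<nu> / 2) * (of_real (2 * pi * u) + \<i> * of_real pi) =
       of_nat n * (\<i> * of_real pi) + of_real \<nu> * (\<i> * of_real pi / 2) + of_real (2 * pi * u * (real n + \<nu> / 2))"
      by (simp add: algebra_simps)
    also have "exp \<dots> = exp (\<i> * of_real pi) ^ n * exp (of_real \<nu> * (\<i> * of_real pi / 2)) * of_real (exp (2 * pi * u * (real n + \<nu> / 2)))"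
      by (simp only: exp_add exp_of_nat_mult exp_of_real)
    finally show ?thesis by (simp add: powr_def mult.commute)
  qed
  have factor: "theta4 (inverse z) qT + e = of_real M * (1 + \<eta>)"
    unfolding th \<eta>_def using M by (simp add: distrib_left)
  have id: "exp (2 * pi * u * (real n + \<nu> / 2)) * M / (2 * T * exp (pi / (12 * T) - pi * T / 3) * qT powr X)
    = exp (pi / T * (T * u + real n + \<nu> / 2)\<^sup>2) / (2 * sqrt T * exp (pi * (1 / (12 * T) - T / 3 - \<nu>\<^sup>2 / (4 * T))))"
  proof -
    have "exp (2 * pi * u * (real n + \<nu> / 2)) * exp (pi * u\<^sup>2 * T) * exp (pi * (1 / (12 * T) - T / 3 - \<nu>\<^sup>2 / (4 * T)))
      = exp (pi / T * (T * u + real n + \<nu> / 2)\<^sup>2) * exp (pi / (12 * T) - pi * T / 3) * qT powr X"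
      unfolding qT_powr X_def exp_add[symmetric] using T by (simp add: power2_eq_square field_simps)
    then show ?thesis
      unfolding M_def using T qT by (intro exp_factor_regroup) auto
  qed
  have "jackson_J2 \<nu> (2 * \<i> * of_real (exp (pi * (u + real n / T + \<nu> / (2 * T))))) qT =
      \<i> powr of_real \<nu> * of_real (exp (2 * pi * u * (real n + \<nu> / 2)) * M / (2 * T * exp (pi / (12 * T) - pi * T / 3) * qT powr X))
        * ((1 + \<eta>) / of_real ((1 + \<delta>)\<^sup>2))"
    using J unfolding arg factor zp \<delta>(1) mult.assoc[symmetric, of 2 \<i>]
      mult.assoc[of "(-1) ^ n * (\<i> powr of_real \<nu>)"] times_divide_eq_right[symmetric] of_real_regroup
    by (simp add: mult_ac)
  also have "(1 + \<eta>) / of_real ((1 + \<delta>)\<^sup>2) = 1 + E" by (simp add: E_def)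
  finally have main: "jackson_J2 \<nu> (2 * \<i> * of_real (exp (pi * (u + real n / T + \<nu> / (2 * T))))) qT =
       \<i> powr of_real \<nu> * of_real (exp (pi / T * (T * u + real n + \<nu> / 2)\<^sup>2)) * (1 + E) /
       of_real (2 * sqrt T * exp (pi * (1 / (12 * T) - T / 3 - \<nu>\<^sup>2 / (4 * T))))"
    unfolding id of_real_divide by (simp only: times_divide_eq_right times_divide_eq_left)
  have co: "0 \<le> cutoff_error qT r n" using cutoff_error_nonneg[OF qT(1,2) r] .
  have "norm e \<le> 2 * (5 * M) * cutoff_error qT r n"
    using theta3_le by (intro order_trans[OF e] mult_right_mono co) (simp add: r_def M_def)
  then have "norm (e / of_real M) \<le> 10 * cutoff_error qT r n"
    using M by (simp add: norm_divide field_simps)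
  then have "norm \<eta> \<le> 4 * exp (- pi * T) + 10 * cutoff_error qT r n"
    unfolding \<eta>_def using norm_triangle_ineq[of "of_real \<epsilon>" "e / of_real M"] \<epsilon>(2) by simp
  moreover have "norm E \<le> 4 * norm \<eta> + 12 * \<bar>\<delta>\<bar>"
    unfolding E_def by (rule divide_square_perturb) (use \<delta> in auto)
  moreover have "exp (- 4 * pi * T) \<le> exp (- pi * T)" using T by simp
  ultimately have "norm E \<le> 64 * exp (- pi * T) + 40 * cutoff_error qT r n"
    using \<delta>(2) by linarith
  with main that show ?thesis unfolding r_def by blast
qed

text \<open>Here z = exp(2 pi u). The extra exp(-pi T/4) of the main term changes T/3 into T/12 and,
  after division, enlarges the cut-off error by exp(pi T/4). The constants are 56 = 4*2 + 12*4 and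
  20 = 4*5.\<close>

lemma jackson_real_argument:
  assumes \<nu>: "-1 < \<nu>"
  obtains E where
    "jackson_J2 \<nu> (2 * of_real (exp (pi * (u + real n / T + \<nu> / (2 * T))))) qT =
       of_real (exp (pi / T * (T * u + real n + \<nu> / 2)\<^sup>2)) * (of_real (cos (pi * T * u)) + E) /
       ((-1) ^ n * of_real (sqrt T * exp (pi * (1 / (12 * T) - T / 12 - \<nu>\<^sup>2 / (4 * T)))))"
    "norm E \<le> 56 * exp (- 2 * pi * T) + 20 * (exp (pi * T / 4) * cutoff_error qT (exp (2 * pi * u)) n)"
proof -
  define r where "r = exp (2 * pi * u)"
  define z where "z = complex_of_real r"
  define M where "M = 2 * sqrt T * exp (pi * u\<^sup>2 * T) * exp (- pi * T / 4)"
  define X where "X = (real n)\<^sup>2 + real n * \<nu> + \<nu>\<^sup>2 / 2"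
  have r: "r > 0" by (simp add: r_def)
  have M: "M > 0" using T by (simp add: M_def)
  have z: "z \<noteq> 0" "norm z = r" using r by (auto simp: z_def)
  obtain e where J: "jackson_J2 \<nu> (2 * csqrt (z * of_real (qT powr (- 2 * real n - \<nu>)))) qT =
       z powr of_real (real n + \<nu> / 2) * (theta4 (inverse z) qT + e) /
         ((-1) ^ n * of_real ((qpoch_inf qT qT)\<^sup>2 * qT powr X))"
    and e: "norm e \<le> 2 * theta3 (inverse r) qT * cutoff_error qT r n"
    using jackson_theta4_error[OF qT(1,2) z(1) \<nu>, of n] unfolding z(2) X_def cutoff_error_def by blast
  have arg: "csqrt (z * of_real (qT powr (- 2 * real n - \<nu>))) = of_real (exp (pi * (u + real n / T + \<nu> / (2 * T))))"
  proof -
    have "z * of_real (qT powr (- 2 * real n - \<nu>)) = of_real ((exp (pi * (u + real n / T + \<nu> / (2 * T))))\<^sup>2)"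
      unfolding argument_square[symmetric] z_def r_def by simp
    then show ?thesis by (subst csqrt_of_real_nonneg) (simp_all del: of_real_power)
  qed
  obtain \<epsilon> where \<epsilon>: "odd_theta (1 / T) (u / (1 / T)) = 2 * sqrt T * exp (- pi * T / 4) * (cos (pi * (u / (1 / T))) + \<epsilon>)"
    "\<bar>\<epsilon>\<bar> \<le> 2 * exp (- 2 * pi * T)"
    using odd_theta_asymp[OF T] by blast
  define c where "c = cos (pi * T * u)"
  have c: "cos (pi * (u / (1 / T))) = c" by (simp add: c_def mult_ac)
  have "inverse z = complex_of_real (exp (- 2 * pi * u))"
    by (simp add: z_def r_def exp_minus)
  then have th: "theta4 (inverse z) qT = of_real (M * (c + \<epsilon>))"
    using theta4_exp[OF qT(3), of u] unfolding \<epsilon>(1) c M_def by (simp add: mult_ac)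
  obtain \<delta> where \<delta>: "(qpoch_inf qT qT)\<^sup>2 = 2 * T * exp (pi / (12 * T) - pi * T / 3) * (1 + \<delta>)\<^sup>2"
    "\<bar>\<delta>\<bar> \<le> 4 * exp (- 4 * pi * T)" "\<bar>\<delta>\<bar> \<le> 1 / 2"
    using qpoch_inf_qT by blast
  define \<eta> where "\<eta> = of_real \<epsilon> + e / of_real M"
  define E where "E = (of_real c + \<eta>) / of_real ((1 + \<delta>)\<^sup>2) - of_real c"
  have zp: "z powr of_real (real n + \<nu> / 2) = of_real (exp (2 * pi * u * (real n + \<nu> / 2)))"
    unfolding z_def r_def by (subst powr_of_real) (simp_all add: powr_def mult.commute)
  have factor: "theta4 (inverse z) qT + e = of_real M * (of_real c + \<eta>)"
    unfolding th \<eta>_def using M by (simp add: distrib_left)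
  have id: "exp (2 * pi * u * (real n + \<nu> / 2)) * M / (2 * T * exp (pi / (12 * T) - pi * T / 3) * qT powr X)
    = exp (pi / T * (T * u + real n + \<nu> / 2)\<^sup>2) / (sqrt T * exp (pi * (1 / (12 * T) - T / 12 - \<nu>\<^sup>2 / (4 * T))))"
  proof -
    have "exp (2 * pi * u * (real n + \<nu> / 2)) * (exp (pi * u\<^sup>2 * T) * exp (- pi * T / 4)) * exp (pi * (1 / (12 * T) - T / 12 - \<nu>\<^sup>2 / (4 * T)))
      = exp (pi / T * (T * u + real n + \<nu> / 2)\<^sup>2) * exp (pi / (12 * T) - pi * T / 3) * qT powr X"
      unfolding qT_powr X_def exp_add[symmetric] using T by (simp add: power2_eq_square field_simps)
    from exp_factor_regroup[OF this, of T "sqrt T"] T qT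
    have "2 * (exp (2 * pi * u * (real n + \<nu> / 2)) * (sqrt T * (exp (pi * u\<^sup>2 * T) * exp (- pi * T / 4)))
         / (2 * T * exp (pi / (12 * T) - pi * T / 3) * qT powr X))
      = 2 * (exp (pi / T * (T * u + real n + \<nu> / 2)\<^sup>2) / (2 * sqrt T * exp (pi * (1 / (12 * T) - T / 12 - \<nu>\<^sup>2 / (4 * T)))))"
      by simp
    moreover have "2 * (a * (s * (b * c)) / d) = a * (2 * s * b * c) / d" "2 * (h / (2 * s * g)) = h / (s * g)"
      for a b c d g h s :: real by simp_all
    ultimately show ?thesis unfolding M_def by (simp only:)
  qed
  have "jackson_J2 \<nu> (2 * of_real (exp (pi * (u + real n / T + \<nu> / (2 * T))))) qT =
      of_real (exp (2 * pi * u * (real n + \<nu> / 2)) * M / (2 * T * exp (pi / (12 * T) - pi * T / 3) * qT powr X))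
        * ((of_real c + \<eta>) / of_real ((1 + \<delta>)\<^sup>2)) / (-1) ^ n"
    using J unfolding arg factor zp \<delta>(1) of_real_regroup .
  also have "(of_real c + \<eta>) / of_real ((1 + \<delta>)\<^sup>2) = of_real c + E" by (simp add: E_def)
  finally have main: "jackson_J2 \<nu> (2 * of_real (exp (pi * (u + real n / T + \<nu> / (2 * T))))) qT =
       of_real (exp (pi / T * (T * u + real n + \<nu> / 2)\<^sup>2)) * (of_real c + E) /
       ((-1) ^ n * of_real (sqrt T * exp (pi * (1 / (12 * T) - T / 12 - \<nu>\<^sup>2 / (4 * T)))))"
    unfolding id of_real_divide by (simp add: field_simps)
  have co: "0 \<le> cutoff_error qT r n" using cutoff_error_nonneg[OF qT(1,2) r] .
  have "M * exp (pi * T / 4) = 2 * (sqrt T * exp (pi * u\<^sup>2 * T)) * (exp (- pi * T / 4) * exp (pi * T / 4))"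
    by (simp add: M_def)
  also have "\<dots> = 2 * (sqrt T * exp (pi * u\<^sup>2 * T))" unfolding exp_add[symmetric] by simp
  finally have ME: "2 * (sqrt T * exp (pi * u\<^sup>2 * T)) = M * exp (pi * T / 4)" ..
  have "norm e \<le> 2 * (5 * (sqrt T * exp (pi * u\<^sup>2 * T))) * cutoff_error qT r n"
    using theta3_le by (intro order_trans[OF e] mult_right_mono co) (simp add: r_def)
  also have "\<dots> = 5 * (2 * (sqrt T * exp (pi * u\<^sup>2 * T))) * cutoff_error qT r n" by simp
  finally have "norm e \<le> 5 * (M * exp (pi * T / 4)) * cutoff_error qT r n" unfolding ME .
  then have "norm (e / of_real M) \<le> 5 * (exp (pi * T / 4) * cutoff_error qT r n)"
    using M by (simp add: norm_divide field_simps)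
  then have "norm \<eta> \<le> 2 * exp (- 2 * pi * T) + 5 * (exp (pi * T / 4) * cutoff_error qT r n)"
    unfolding \<eta>_def using norm_triangle_ineq[of "of_real \<epsilon>" "e / of_real M"] \<epsilon>(2) by simp
  moreover have "norm E \<le> 4 * norm \<eta> + 12 * \<bar>\<delta>\<bar>"
    unfolding E_def by (rule divide_square_perturb) (use \<delta> in \<open>auto simp: c_def\<close>)
  moreover have "exp (- 4 * pi * T) \<le> exp (- 2 * pi * T)" using T by simp
  ultimately have "norm E \<le> 56 * exp (- 2 * pi * T) + 20 * (exp (pi * T / 4) * cutoff_error qT r n)"
    using \<delta>(2) by linarith
  with main that show ?thesis unfolding r_def c_def by blast
qed

text \<open>The rate 3 leaves room for the loss of 1/4 in the real case, where 2 is required. From n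
  >= 8 T^2 comes q^(n/2) <= exp(-4 pi T), and one factor exp(pi T) is spent on 1/(1-q).\<close>

lemma cutoff_error_le:
  assumes n: "8 * T\<^sup>2 \<le> real n" "3 \<le> n" and u: "3 * (3 + 2 * \<bar>u\<bar>) \<le> 8 * T"
  shows "cutoff_error qT (exp (2 * pi * u)) n \<le> 2 * exp (- 3 * pi * T)"
proof -
  define N where "N = n div 2"
  have "qT powr (real n / 2) / (1 - qT) \<le> exp (- 3 * pi * T)"
  proof -
    have x: "pi * (1 / T) > 0" using T by simp
    \<comment> \<open>This yields 1 - q >= pi/(T + pi), hence 1/(1-q) <= 1 + T.\<close>
    have "1 + pi * (1 / T) \<le> exp (pi * (1 / T))" by (rule exp_ge_add_one_self)
    then have "qT \<le> 1 / (1 + pi * (1 / T))"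
      using x by (simp add: exp_minus field_simps)
    then have "1 - qT \<ge> 1 - 1 / (1 + pi * (1 / T))" by linarith
    also have "1 - 1 / (1 + pi * (1 / T)) = pi / (T + pi)"
    proof -
      have "1 + pi * (1 / T) = (T + pi) / T" using T by (simp add: add_divide_distrib)
      moreover have "T + pi \<noteq> 0" using T pi_gt_zero by linarith
      ultimately show ?thesis using diff_divide_distrib[of "T + pi" T "T + pi"] by simp
    qed
    finally have lower: "pi / (T + pi) \<le> 1 - qT" .
    have "0 < pi / (T + pi)" using T by (simp add: add_pos_pos)
    from frac_le[OF zero_le_one order_refl this lower] have "1 / (1 - qT) \<le> 1 / (pi / (T + pi))" .
    also have "\<dots> \<le> 1 + T"
    proof -
      have "T \<le> pi * T" using T pi_gt3 by simp
      then show ?thesis by (simp add: field_simps)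
    qed
    also have "\<dots> \<le> exp T" by (rule exp_ge_add_one_self)
    also have "\<dots> \<le> exp (pi * T)" using T pi_gt3 by simp
    finally have 1: "1 / (1 - qT) \<le> exp (pi * T)" .
    have "4 * T \<le> real n / 2 / T"
      using n(1) T by (simp add: field_simps power2_eq_square)
    then have "pi * (4 * T) \<le> pi * (real n / 2 / T)" by (intro mult_left_mono) auto
    then have 2: "qT powr (real n / 2) \<le> exp (- 4 * pi * T)"
      unfolding qT_powr by simp
    have "qT powr (real n / 2) * (1 / (1 - qT)) \<le> exp (- 4 * pi * T) * exp (pi * T)"
      using qT by (intro mult_mono 1 2) auto
    also have "\<dots> = exp (- 3 * pi * T)" unfolding exp_add[symmetric] by simp
    finally show ?thesis by simp
  qed
  moreover have "qT ^ N\<^sup>2 / exp (2 * pi * u) ^ N \<le> exp (- 3 * pi * T)"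
  proof -
    \<comment> \<open>The resulting N >= (3 + 2|u|) T gives N >= T and N/T + 2u >= 3 for either sign
      of \<open>u\<close>; their product controls the exponent.\<close>
    have "3 * (3 + 2 * \<bar>u\<bar>) * T \<le> 8 * T * T" using u T by (intro mult_right_mono) auto
    also have "\<dots> \<le> real n" using n(1) by (simp add: power2_eq_square)
    also have "real n \<le> 3 * real N" using n(2) unfolding N_def by linarith
    finally have "3 * ((3 + 2 * \<bar>u\<bar>) * T) \<le> 3 * real N" by (simp only: mult.assoc)
    then have N: "(3 + 2 * \<bar>u\<bar>) * T \<le> real N" by linarith
    then have "3 + 2 * \<bar>u\<bar> \<le> real N / T" using T by (simp add: field_simps)
    then have 1: "3 \<le> real N / T + 2 * u" by linarith
    have "1 * T \<le> (3 + 2 * \<bar>u\<bar>) * T" using T by (intro mult_right_mono) auto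
    then have "T \<le> real N" using N by simp
    then have "3 * T \<le> (real N / T + 2 * u) * real N"
      using 1 T by (intro mult_mono) auto
    then have le: "pi * (3 * T) \<le> pi * ((real N / T + 2 * u) * real N)" by (intro mult_left_mono) auto
    have "qT ^ N\<^sup>2 / exp (2 * pi * u) ^ N = exp (- (pi * ((real N / T + 2 * u) * real N)))"
      unfolding exp_of_nat_mult[symmetric] exp_diff[symmetric]
      by (simp add: power2_eq_square algebra_simps)
    also have "\<dots> \<le> exp (- 3 * pi * T)" using le by simp
    finally show ?thesis .
  qed
  ultimately show ?thesis unfolding cutoff_error_def N_def by linarith
qed

end

text \<open>This is where a < 1/2 enters: for T = n^a the quotient n/T^2 = n^(1-2a) eventually
  exceeds 8, while the condition on \<open>u\<close> follows from T tending to infinity.\<close>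

lemma eventually_cutoff_conditions:
  fixes a u :: real
  assumes a: "0 < a" "a < 1 / 2"
  shows "\<forall>\<^sub>F n in sequentially. 1 \<le> n \<and> 1 \<le> real n powr a \<and>
    cutoff_error (exp (- pi * (1 / real n powr a))) (exp (2 * pi * u)) n \<le> 2 * exp (- 3 * pi * real n powr a)"
proof -
  have 1: "filterlim (\<lambda>n. real n powr a) at_top sequentially"
    using a by real_asymp
  have 2: "filterlim (\<lambda>n. real n powr (1 - 2 * a)) at_top sequentially"
    using a by real_asymp
  have "\<forall>\<^sub>F n in sequentially. 3 * (3 + 2 * \<bar>u\<bar>) \<le> real n powr a"
    using 1 by (simp add: filterlim_at_top)
  moreover have "\<forall>\<^sub>F n in sequentially. 8 \<le> real n powr (1 - 2 * a)"
    using 2 by (simp add: filterlim_at_top)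
  ultimately show ?thesis
    using eventually_ge_at_top[of 3]
  proof eventually_elim
    case (elim n)
    define T where "T = real n powr a"
    have T: "1 \<le> T" using elim(3) a by (simp add: T_def ge_one_powr_ge_zero)
    have "T\<^sup>2 * real n powr (1 - 2 * a) = real n"
      unfolding T_def power2_eq_square powr_add[symmetric] using elim(3) by simp
    moreover have "T\<^sup>2 * 8 \<le> T\<^sup>2 * real n powr (1 - 2 * a)" using elim(2) by (intro mult_left_mono) auto
    ultimately have "8 * T\<^sup>2 \<le> real n" by simp
    moreover have "3 * (3 + 2 * \<bar>u\<bar>) \<le> 8 * T" using elim(1) T unfolding T_def by linarith
    ultimately show ?case
      using cutoff_error_le[OF T _ elim(3)] T elim(3) unfolding T_def by auto
  qed
qed

theorem theorem2p4:
  "(\<forall>(q::real) (z::complex) (\<nu>::real) (e::nat \<Rightarrow> complex).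
      0 < q \<and> q < 1 \<and> z \<noteq> 0 \<and> \<nu> > -1 \<and>
      (\<forall>n. jackson_J2 \<nu> (2 * csqrt (z * of_real (q powr (- 2 * real n - \<nu>)))) q =
             z powr of_real (real n + \<nu> / 2) * (theta4 (inverse z) q + e n) /
             ((-1) ^ n * of_real ((qpoch_inf q q)\<^sup>2 *
                q powr ((real n)\<^sup>2 + real n * \<nu> + \<nu>\<^sup>2 / 2))))
      \<longrightarrow> (\<forall>\<^sub>F n in sequentially.
             norm (e n) \<le> 12 * theta3 (inverse (norm z)) q *
               (q powr (real n / 2) / (1 - q) + q ^ ((n div 2)\<^sup>2) / norm z ^ (n div 2))))
   \<and>
   (\<forall>(\<nu>::real) (a::real) (u::real).
      \<nu> > -1 \<and> 0 < a \<and> a < 1 / 2 \<longrightarrow>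
      (\<exists>E::nat \<Rightarrow> complex.
         E \<in> O(\<lambda>n. of_real (exp (- pi * real n powr a))) \<and>
         (\<forall>n\<ge>1.
            jackson_J2 \<nu>
              (2 * \<i> * of_real (exp (pi * (u + real n powr (1 - a) + \<nu> * real n powr (- a) / 2))))
              (exp (- pi * real n powr (- a))) =
            \<i> powr of_real \<nu> *
              of_real (exp (pi * real n powr (- a) * (real n powr a * u + real n + \<nu> / 2)\<^sup>2)) *
              (1 + E n) /
            of_real (2 * sqrt (real n powr a) *
              exp (pi * (real n powr (- a) / 12 - real n powr a / 3 - real n powr (- a) * \<nu>\<^sup>2 / 4)))))
      \<and>
      (\<exists>E::nat \<Rightarrow> complex.
         E \<in> O(\<lambda>n. of_real (exp (- 2 * pi * real n powr a))) \<and>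
         (\<forall>n\<ge>1.
            jackson_J2 \<nu>
              (2 * of_real (exp (pi * (u + real n powr (1 - a) + \<nu> * real n powr (- a) / 2))))
              (exp (- pi * real n powr (- a))) =
            of_real (exp (pi * real n powr (- a) * (real n powr a * u + real n + \<nu> / 2)\<^sup>2)) *
              (of_real (cos (pi * real n powr a * u)) + E n) /
            ((-1) ^ n * of_real (sqrt (real n powr a) *
              exp (pi * (real n powr (- a) / 12 - real n powr a / 12 - \<nu>\<^sup>2 * real n powr (- a) / 4)))))))"
proof (intro conjI allI impI)
  fix q :: real and z :: complex and \<nu> :: real and e :: "nat \<Rightarrow> complex"
  assume asm: "0 < q \<and> q < 1 \<and> z \<noteq> 0 \<and> \<nu> > -1 \<and>
      (\<forall>n. jackson_J2 \<nu> (2 * csqrt (z * of_real (q powr (- 2 * real n - \<nu>)))) q =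
             z powr of_real (real n + \<nu> / 2) * (theta4 (inverse z) q + e n) /
             ((-1) ^ n * of_real ((qpoch_inf q q)\<^sup>2 *
                q powr ((real n)\<^sup>2 + real n * \<nu> + \<nu>\<^sup>2 / 2))))"
  then have q: "0 < q" "q < 1" and z: "z \<noteq> 0" and \<nu>: "-1 < \<nu>"
    and J: "jackson_J2 \<nu> (2 * csqrt (z * of_real (q powr (- 2 * real n - \<nu>)))) q =
             z powr of_real (real n + \<nu> / 2) * (theta4 (inverse z) q + e n) /
             ((-1) ^ n * of_real ((qpoch_inf q q)\<^sup>2 *
                q powr ((real n)\<^sup>2 + real n * \<nu> + \<nu>\<^sup>2 / 2)))" for n
    by blast+
  have "norm (e n) \<le> 12 * theta3 (inverse (norm z)) q *
      (q powr (real n / 2) / (1 - q) + q ^ ((n div 2)\<^sup>2) / norm z ^ (n div 2))" for n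
  proof -
    let ?D = "(-1) ^ n * complex_of_real ((qpoch_inf q q)\<^sup>2 * q powr ((real n)\<^sup>2 + real n * \<nu> + \<nu>\<^sup>2 / 2))"
    let ?B = "theta3 (inverse (norm z)) q * (q powr (real n / 2) / (1 - q) + q ^ ((n div 2)\<^sup>2) / norm z ^ (n div 2))"
    obtain e' where e': "jackson_J2 \<nu> (2 * csqrt (z * of_real (q powr (- 2 * real n - \<nu>)))) q =
        z powr of_real (real n + \<nu> / 2) * (theta4 (inverse z) q + e') / ?D"
      "norm e' \<le> 2 * theta3 (inverse (norm z)) q *
        (q powr (real n / 2) / (1 - q) + q ^ ((n div 2)\<^sup>2) / norm z ^ (n div 2))"
      by (rule jackson_theta4_error[OF q z \<nu>, of n])
    \<comment> \<open>The defining identity determines e(n), since neither the denominator nor the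
      power of \<open>z\<close> vanishes.\<close>
    have "?D \<noteq> 0" using qpoch_inf_pos[OF q q] q by simp
    moreover have "z powr of_real (real n + \<nu> / 2) \<noteq> 0" using z by simp
    ultimately have "e n = e'" using J[of n] e'(1) by simp
    then have "norm (e n) \<le> 2 * ?B" using e'(2) by (simp only: mult.assoc)
    moreover from this have "0 \<le> ?B" using norm_ge_zero[of "e n"] by linarith
    ultimately have "norm (e n) \<le> 12 * ?B" by linarith
    then show ?thesis by (simp only: mult.assoc)
  qed
  then show "\<forall>\<^sub>F n in sequentially. norm (e n) \<le> 12 * theta3 (inverse (norm z)) q *
      (q powr (real n / 2) / (1 - q) + q ^ ((n div 2)\<^sup>2) / norm z ^ (n div 2))"
    by simp
next
  fix \<nu> a u :: real
  assume asm: "\<nu> > -1 \<and> 0 < a \<and> a < 1 / 2"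
  then have \<nu>: "-1 < \<nu>" and a: "0 < a" "a < 1 / 2" by auto
  let ?T = "\<lambda>n. real n powr a"
  let ?err = "\<lambda>n. cutoff_error (exp (- pi * (1 / ?T n))) (exp (2 * pi * u)) n"
  have T: "1 \<le> ?T n" if "1 \<le> n" for n using that a by (simp add: ge_one_powr_ge_zero)
  have T0: "?T n > 0" if "1 \<le> n" for n using that by simp
  have inv: "real n powr (- a) = 1 / ?T n" for n by (rule powr_minus_divide)
  have quot: "real n powr (1 - a) = real n / ?T n" if "1 \<le> n" for n
    using that by (simp add: powr_diff)
  \<comment> \<open>The error is chosen separately for each n >= 1, together with its explicit
    bound; its value at 0 is arbitrary.\<close>
  have "\<forall>n. \<exists>E. 1 \<le> n \<longrightarrow>
     (jackson_J2 \<nu> (2 * \<i> * of_real (exp (pi * (u + real n powr (1 - a) + \<nu> * real n powr (- a) / 2))))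
              (exp (- pi * real n powr (- a))) =
            \<i> powr of_real \<nu> *
              of_real (exp (pi * real n powr (- a) * (real n powr a * u + real n + \<nu> / 2)\<^sup>2)) *
              (1 + E) /
            of_real (2 * sqrt (real n powr a) *
              exp (pi * (real n powr (- a) / 12 - real n powr a / 3 - real n powr (- a) * \<nu>\<^sup>2 / 4)))
      \<and> norm E \<le> 64 * exp (- pi * ?T n) + 40 * ?err n)" (is "\<forall>n. \<exists>E. 1 \<le> n \<longrightarrow> ?P n E")
  proof
    fix n
    show "\<exists>E. 1 \<le> n \<longrightarrow> ?P n E"
    proof (cases "1 \<le> n")
      case True
      have r1: "pi * (u + real n / ?T n + \<nu> * (1 / ?T n) / 2) = pi * (u + real n / ?T n + \<nu> / (2 * ?T n))"
        by simp
      have r2: "pi * (1 / ?T n) * y = pi / ?T n * y" for y by simp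
      have r3: "1 / ?T n / 12 - ?T n / 3 - 1 / ?T n * \<nu>\<^sup>2 / 4 = 1 / (12 * ?T n) - ?T n / 3 - \<nu>\<^sup>2 / (4 * ?T n)"
        by simp
      show ?thesis
        using jackson_imaginary_argument[OF T[OF True] \<nu>, of u n]
        unfolding inv quot[OF True] r1 r2 r3 by blast
    qed simp
  qed
  then obtain E where E: "\<And>n. 1 \<le> n \<Longrightarrow> ?P n (E n)" by metis
  have "E \<in> O(\<lambda>n. of_real (exp (- pi * ?T n)))"
  \<comment> \<open>144 = 64 + 40*2, by the eventual bound on the cut-off error.\<close>
  proof (rule bigoI[where c = 144])
    show "\<forall>\<^sub>F n in sequentially. norm (E n) \<le> 144 * norm (complex_of_real (exp (- pi * ?T n)))"
      using eventually_cutoff_conditions[OF a, of u]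
    proof eventually_elim
      case (elim n)
      then have "exp (- 3 * pi * ?T n) \<le> exp (- pi * ?T n)" by simp
      moreover have "norm (E n) \<le> 64 * exp (- pi * ?T n) + 40 * ?err n"
        using E elim by blast
      ultimately show ?case
        using elim unfolding norm_of_real abs_exp_cancel by linarith
    qed
  qed
  then show "\<exists>E::nat \<Rightarrow> complex.
         E \<in> O(\<lambda>n. of_real (exp (- pi * real n powr a))) \<and>
         (\<forall>n\<ge>1.
            jackson_J2 \<nu>
              (2 * \<i> * of_real (exp (pi * (u + real n powr (1 - a) + \<nu> * real n powr (- a) / 2))))
              (exp (- pi * real n powr (- a))) =
            \<i> powr of_real \<nu> *
              of_real (exp (pi * real n powr (- a) * (real n powr a * u + real n + \<nu> / 2)\<^sup>2)) *
              (1 + E n) /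
            of_real (2 * sqrt (real n powr a) *
              exp (pi * (real n powr (- a) / 12 - real n powr a / 3 - real n powr (- a) * \<nu>\<^sup>2 / 4))))"
    using E by blast
  have "\<forall>n. \<exists>E. 1 \<le> n \<longrightarrow>
     (jackson_J2 \<nu> (2 * of_real (exp (pi * (u + real n powr (1 - a) + \<nu> * real n powr (- a) / 2))))
              (exp (- pi * real n powr (- a))) =
            of_real (exp (pi * real n powr (- a) * (real n powr a * u + real n + \<nu> / 2)\<^sup>2)) *
              (of_real (cos (pi * real n powr a * u)) + E) /
            ((-1) ^ n * of_real (sqrt (real n powr a) *
              exp (pi * (real n powr (- a) / 12 - real n powr a / 12 - \<nu>\<^sup>2 * real n powr (- a) / 4))))
      \<and> norm E \<le> 56 * exp (- 2 * pi * ?T n) + 20 * (exp (pi * ?T n / 4) * ?err n))" (is "\<forall>n. \<exists>E. 1 \<le> n \<longrightarrow> ?Q n E")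
  proof
    fix n
    show "\<exists>E. 1 \<le> n \<longrightarrow> ?Q n E"
    proof (cases "1 \<le> n")
      case True
      have r1: "pi * (u + real n / ?T n + \<nu> * (1 / ?T n) / 2) = pi * (u + real n / ?T n + \<nu> / (2 * ?T n))"
        by simp
      have r2: "pi * (1 / ?T n) * y = pi / ?T n * y" for y by simp
      have r3: "1 / ?T n / 12 - ?T n / 12 - \<nu>\<^sup>2 * (1 / ?T n) / 4 = 1 / (12 * ?T n) - ?T n / 12 - \<nu>\<^sup>2 / (4 * ?T n)"
        by simp
      show ?thesis
        using jackson_real_argument[OF T[OF True] \<nu>, of u n]
        unfolding inv quot[OF True] r1 r2 r3 by blast
    qed simp
  qed
  then obtain F where F: "\<And>n. 1 \<le> n \<Longrightarrow> ?Q n (F n)" by metis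
  have "F \<in> O(\<lambda>n. of_real (exp (- 2 * pi * ?T n)))"
  \<comment> \<open>96 = 56 + 20*2, since the enlarged cut-off error still decays at rate 3 - 1/4 =
    11/4, which exceeds 2.\<close>
  proof (rule bigoI[where c = 96])
    show "\<forall>\<^sub>F n in sequentially. norm (F n) \<le> 96 * norm (complex_of_real (exp (- 2 * pi * ?T n)))"
      using eventually_cutoff_conditions[OF a, of u]
    proof eventually_elim
      case (elim n)
      then have "exp (pi * ?T n / 4) * ?err n \<le> exp (pi * ?T n / 4) * (2 * exp (- 3 * pi * ?T n))"
        by (intro mult_left_mono) auto
      also have "\<dots> = 2 * exp (- (11 / 4) * pi * ?T n)"
        unfolding mult.left_commute[of _ 2] exp_add[symmetric] by simp
      also have "\<dots> \<le> 2 * exp (- 2 * pi * ?T n)" using elim by simp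
      finally have "exp (pi * ?T n / 4) * ?err n \<le> 2 * exp (- 2 * pi * ?T n)" .
      moreover have "norm (F n) \<le> 56 * exp (- 2 * pi * ?T n) + 20 * (exp (pi * ?T n / 4) * ?err n)"
        using F elim by blast
      ultimately show ?case
        unfolding norm_of_real abs_exp_cancel by linarith
    qed
  qed
  then show "\<exists>E::nat \<Rightarrow> complex.
         E \<in> O(\<lambda>n. of_real (exp (- 2 * pi * real n powr a))) \<and>
         (\<forall>n\<ge>1.
            jackson_J2 \<nu>
              (2 * of_real (exp (pi * (u + real n powr (1 - a) + \<nu> * real n powr (- a) / 2))))
              (exp (- pi * real n powr (- a))) =
            of_real (exp (pi * real n powr (- a) * (real n powr a * u + real n + \<nu> / 2)\<^sup>2)) *
              (of_real (cos (pi * real n powr a * u)) + E n) /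
            ((-1) ^ n * of_real (sqrt (real n powr a) *
              exp (pi * (real n powr (- a) / 12 - real n powr a / 12 - \<nu>\<^sup>2 * real n powr (- a) / 4)))))"
    using F by blast
qed

end
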